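(* For each prime $p\ge 7$, $\mathcal{G}_{6p^4}$ is a connected pentavalent symmetric graph admitting a quasi-semiregular automorphism, and $\mathrm{Aut}(\mathcal{G}_{6p^4})\cong\mathbb{Z}_p^4\rtimes\mathrm{S}_5$.
   Context: Graphs are finite, undirected and simple. A graph is symmetric if its automorphism group is transitive on vertices and on arcs. A non-identity automorphism is quasi-semiregular if it fixes a unique vertex and all its cycles on the other vertices have the same length. Coset graphs: for a core-free subgroup $H$ of a group $G$ and $x\in G\setminus H$ with $HxH=Hx^{-1}H$, $\mathrm{Cos}(G,H,HxH)$ has as vertices the right cosets of $H$ in $G$ and edge set $\{\{Hg,Hyg\}: g\in G, y\in HxH\}$. Construction of $\mathcal{G}_{6p^4}$ ($p$ an odd prime). Automorphisms and permutations act on the right (written $x^\delta$) and are composed left to right. Let $M=\langle a\rangle\times\langle b\rangle\times\langle c\rangle\times\langle d\rangle\cong\mathbb{Z}_p^4$, $e=a^{-1}b^{-1}c^{-1}d^{-1}$ and $\Delta=\{a,b,c,d,e\}$. The subgroup $\mathrm{Aut}(M,\Delta)$ of $\mathrm{Aut}(M)$ fixing $\Delta$ setwise induces the full symmetric group $\mathrm{S}_\Delta$ faithfully on $\Delta$ and is identified with $\mathrm{S}_\Delta$; $\mathrm{A}_\Delta$ denotes the alternating group on $\Delta$, viewed as a subgroup of $\mathrm{Aut}(M)$. Let $\beta\in\mathrm{Aut}(M)$ be the automorphism with $a\mapsto b^{-1}$, $b\mapsto d^{-1}$, $c\mapsto a^{-1}$, $d\mapsto c^{-1}$ (so $e\mapsto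 e^{-1}$), and let $L=\langle\mathrm{A}_\Delta,\beta\rangle\le\mathrm{Aut}(M)$; one has $L\cong\mathrm{S}_5$. Let $G=M\rtimes L$, with elements $x\delta$ ($x\in M$, $\delta\in L$) and $x\delta=\delta x^\delta$, where $x^\delta$ is the image of $x$ under $\delta$. Put $\alpha=(a,b,c,d,e)\in\mathrm{A}_\Delta$, $\gamma=(a,b)(c,d)\in\mathrm{A}_\Delta$, $u=ab^{-1}c^{-1}d\in M$, $H=\langle\alpha,\beta\rangle$ and $\gamma^u=u^{-1}\gamma u$. Define $\mathcal{G}_{6p^4}=\mathrm{Cos}(G,H,H\gamma^uH)$. *)

theory Defs
  imports "HOL-Computational_Algebra.Primes" "HOL-Combinatorics.Orbits"
    "HOL-Algebra.Bij" "HOL-Algebra.Elementary_Groups" "HOL-Algebra.Sym_Groups"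
    "Graph_Theory.Graph_Theory"
begin

text \<open>
  A finite simple undirected graph is a \<^locale>\<open>pair_graph\<close>: a finite, loopless, symmetric
  set of ordered pairs (the arcs of the graph).
\<close>

definition graph_auts :: "'v pair_pre_digraph \<Rightarrow> ('v \<Rightarrow> 'v) set" where
  "graph_auts X = {f \<in> Bij (pverts X).
     \<forall>u \<in> pverts X. \<forall>v \<in> pverts X. (f u, f v) \<in> parcs X \<longleftrightarrow> (u, v) \<in> parcs X}"

definition graph_aut_group :: "'v pair_pre_digraph \<Rightarrow> ('v \<Rightarrow> 'v) monoid" where
  "graph_aut_group X = BijGroup (pverts X) \<lparr>carrier := graph_auts X\<rparr>"

definition symmetric_graph :: "'v pair_pre_digraph \<Rightarrow> bool" where
  "symmetric_graph X \<longleftrightarrow>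
     (\<forall>u \<in> pverts X. \<forall>v \<in> pverts X. \<exists>f \<in> graph_auts X. f u = v) \<and>
     (\<forall>(u, v) \<in> parcs X. \<forall>(u', v') \<in> parcs X. \<exists>f \<in> graph_auts X. f u = u' \<and> f v = v')"

definition regular_of_valency :: "nat \<Rightarrow> 'v pair_pre_digraph \<Rightarrow> bool" where
  "regular_of_valency k X \<longleftrightarrow> (\<forall>v \<in> pverts X. out_degree (with_proj X) v = k)"

text \<open>\<^term>\<open>orbit f u\<close> is the cycle of the permutation \<^term>\<open>f\<close> through \<^term>\<open>u\<close>.\<close>

definition quasi_semiregular :: "'v pair_pre_digraph \<Rightarrow> ('v \<Rightarrow> 'v) \<Rightarrow> bool" where
  "quasi_semiregular X f \<longleftrightarrow>
     f \<in> graph_auts X \<and> f \<noteq> \<one>\<^bsub>graph_aut_group X\<^esub> \<and>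
     (\<exists>!v. v \<in> pverts X \<and> f v = v) \<and>
     (\<exists>n. \<forall>u \<in> pverts X. f u \<noteq> u \<longrightarrow> card (orbit f u) = n)"

definition double_coset :: "('g, 'm) monoid_scheme \<Rightarrow> 'g set \<Rightarrow> 'g \<Rightarrow> 'g set" where
  "double_coset G H x = (H #>\<^bsub>G\<^esub> x) <#>\<^bsub>G\<^esub> H"

definition coset_graph_edges :: "('g, 'm) monoid_scheme \<Rightarrow> 'g set \<Rightarrow> 'g set \<Rightarrow> 'g set set set" where
  "coset_graph_edges G H D =
     {{H #>\<^bsub>G\<^esub> g, H #>\<^bsub>G\<^esub> (y \<otimes>\<^bsub>G\<^esub> g)} | g y. g \<in> carrier G \<and> y \<in> D}"

text \<open>
  For a subgroup \<open>H\<close> and \<open>D = HxH\<close> with \<open>x\<close> outside \<open>H\<close>, every edge below has two ends. The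
  usual side conditions (\<open>H\<close> core-free, \<open>HxH\<close> closed under inverses) do not enter the formula.
\<close>

definition coset_graph :: "('g, 'm) monoid_scheme \<Rightarrow> 'g set \<Rightarrow> 'g set \<Rightarrow> 'g set pair_pre_digraph" where
  "coset_graph G H D =
     \<lparr>pverts = rcosets\<^bsub>G\<^esub> H, parcs = {(U, V). {U, V} \<in> coset_graph_edges G H D}\<rparr>"

text \<open>
  \<^term>\<open>act k x\<close> is a right action \<open>x\<^sup>k\<close> of \<open>K\<close> on \<open>N\<close> by automorphisms, and the pair \<open>(x, k)\<close>
  stands for the product \<open>x k\<close>. The rule \<open>x k = k x\<^sup>k\<close> means that \<open>k y\<close> is the product of
  \<open>y\<close> raised to the inverse of \<open>k\<close> with \<open>k\<close>, which explains the inverse below.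
\<close>

definition semidirect_product ::
  "('a, 'm) monoid_scheme \<Rightarrow> ('b, 'n) monoid_scheme \<Rightarrow> ('b \<Rightarrow> 'a \<Rightarrow> 'a) \<Rightarrow> ('a \<times> 'b) monoid" where
  "semidirect_product N K act =
     \<lparr>carrier = carrier N \<times> carrier K,
      mult = (\<lambda>(x, k) (y, l). (x \<otimes>\<^bsub>N\<^esub> act (inv\<^bsub>K\<^esub> k) y, k \<otimes>\<^bsub>K\<^esub> l)),
      one = (\<one>\<^bsub>N\<^esub>, \<one>\<^bsub>K\<^esub>)\<rparr>"

text \<open>
  \<^const>\<open>AutoGroup\<close> composes functions from right to left. Automorphisms acting on the right
  are composed from left to right, so the multiplication has to be reversed.
\<close>

definition right_AutoGroup :: "('a, 'm) monoid_scheme \<Rightarrow> ('a \<Rightarrow> 'a) monoid" where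
  "right_AutoGroup N = AutoGroup N \<lparr>mult := (\<lambda>f g. g \<otimes>\<^bsub>AutoGroup N\<^esub> f)\<rparr>"

text \<open>Elements of \<open>M\<close> are exponent vectors: \<open>(i, j, k, l)\<close> is the product of the powers
  \<open>a\<^sup>i\<close>, \<open>b\<^sup>j\<close>, \<open>c\<^sup>k\<close>, \<open>d\<^sup>l\<close>.\<close>

type_synonym vec4 = "int \<times> int \<times> int \<times> int"

definition grpM :: "nat \<Rightarrow> vec4 monoid" where
  "grpM p = integer_mod_group p \<times>\<times> (integer_mod_group p \<times>\<times>
              (integer_mod_group p \<times>\<times> integer_mod_group p))"

definition genA :: vec4 where "genA = (1, 0, 0, 0)"
definition genB :: vec4 where "genB = (0, 1, 0, 0)"
definition genC :: vec4 where "genC = (0, 0, 1, 0)"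
definition genD :: vec4 where "genD = (0, 0, 0, 1)"

definition genE :: "nat \<Rightarrow> vec4" where
  "genE p = inv\<^bsub>grpM p\<^esub> genA \<otimes>\<^bsub>grpM p\<^esub> inv\<^bsub>grpM p\<^esub> genB
              \<otimes>\<^bsub>grpM p\<^esub> inv\<^bsub>grpM p\<^esub> genC \<otimes>\<^bsub>grpM p\<^esub> inv\<^bsub>grpM p\<^esub> genD"

definition Delta :: "nat \<Rightarrow> vec4 set" where
  "Delta p = {genA, genB, genC, genD, genE p}"

definition Aut_M_Delta :: "nat \<Rightarrow> (vec4 \<Rightarrow> vec4) set" where
  "Aut_M_Delta p = {\<sigma> \<in> auto (grpM p). \<sigma> ` Delta p = Delta p}"

definition A_Delta :: "nat \<Rightarrow> (vec4 \<Rightarrow> vec4) set" where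
  "A_Delta p = {\<sigma> \<in> Aut_M_Delta p. evenperm (\<lambda>x. if x \<in> Delta p then \<sigma> x else x)}"

text \<open>The endomorphism of \<open>M\<close> mapping the generators \<open>a, b, c, d\<close> to the given elements,
  restricted to the carrier as the elements of \<^const>\<open>auto\<close> are.\<close>

definition endo_M :: "nat \<Rightarrow> vec4 \<Rightarrow> vec4 \<Rightarrow> vec4 \<Rightarrow> vec4 \<Rightarrow> vec4 \<Rightarrow> vec4" where
  "endo_M p a' b' c' d' =
     restrict (\<lambda>(i, j, k, l). a' [^]\<^bsub>grpM p\<^esub> i \<otimes>\<^bsub>grpM p\<^esub> b' [^]\<^bsub>grpM p\<^esub> j
                 \<otimes>\<^bsub>grpM p\<^esub> c' [^]\<^bsub>grpM p\<^esub> k \<otimes>\<^bsub>grpM p\<^esub> d' [^]\<^bsub>grpM p\<^esub> l)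
       (carrier (grpM p))"

definition aut_alpha :: "nat \<Rightarrow> vec4 \<Rightarrow> vec4" where
  "aut_alpha p = endo_M p genB genC genD (genE p)"

definition aut_beta :: "nat \<Rightarrow> vec4 \<Rightarrow> vec4" where
  "aut_beta p = endo_M p (inv\<^bsub>grpM p\<^esub> genB) (inv\<^bsub>grpM p\<^esub> genD)
                         (inv\<^bsub>grpM p\<^esub> genA) (inv\<^bsub>grpM p\<^esub> genC)"

definition aut_gamma :: "nat \<Rightarrow> vec4 \<Rightarrow> vec4" where
  "aut_gamma p = endo_M p genB genA genD genC"

definition grpL :: "nat \<Rightarrow> (vec4 \<Rightarrow> vec4) monoid" where
  "grpL p = subgroup_generated (right_AutoGroup (grpM p)) (A_Delta p \<union> {aut_beta p})"

definition grpG :: "nat \<Rightarrow> (vec4 \<times> (vec4 \<Rightarrow> vec4)) monoid" where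
  "grpG p = semidirect_product (grpM p) (grpL p) (\<lambda>\<delta> x. \<delta> x)"

definition inM :: "nat \<Rightarrow> vec4 \<Rightarrow> vec4 \<times> (vec4 \<Rightarrow> vec4)" where
  "inM p x = (x, \<one>\<^bsub>grpL p\<^esub>)"

definition inL :: "nat \<Rightarrow> (vec4 \<Rightarrow> vec4) \<Rightarrow> vec4 \<times> (vec4 \<Rightarrow> vec4)" where
  "inL p \<delta> = (\<one>\<^bsub>grpM p\<^esub>, \<delta>)"

definition elt_u :: "nat \<Rightarrow> vec4" where
  "elt_u p = genA \<otimes>\<^bsub>grpM p\<^esub> inv\<^bsub>grpM p\<^esub> genB \<otimes>\<^bsub>grpM p\<^esub> inv\<^bsub>grpM p\<^esub> genC \<otimes>\<^bsub>grpM p\<^esub> genD"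

definition gamma_u :: "nat \<Rightarrow> vec4 \<times> (vec4 \<Rightarrow> vec4)" where
  "gamma_u p = inv\<^bsub>grpG p\<^esub> (inM p (elt_u p)) \<otimes>\<^bsub>grpG p\<^esub> inL p (aut_gamma p)
                 \<otimes>\<^bsub>grpG p\<^esub> inM p (elt_u p)"

definition grpH :: "nat \<Rightarrow> (vec4 \<times> (vec4 \<Rightarrow> vec4)) set" where
  "grpH p = generate (grpG p) {inL p (aut_alpha p), inL p (aut_beta p)}"

definition graph_6p4 :: "nat \<Rightarrow> (vec4 \<times> (vec4 \<Rightarrow> vec4)) set pair_pre_digraph" where
  "graph_6p4 p = coset_graph (grpG p) (grpH p) (double_coset (grpG p) (grpH p) (gamma_u p))"

end

theory Submission
  imports Defs "HOL-Library.Product_Plus" "HOL-Combinatorics.Multiset_Permutations"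
begin

text \<open>
  The group \<open>G = M \<rtimes> L\<close> acts on the graph by right multiplication of cosets. The translations
  in \<open>M\<close> act freely with six orbits, one for each coset of \<open>H\<close> in \<open>L\<close>. Here \<open>L\<close> is \<open>S\<^sub>5\<close>, each
  odd permutation being twisted by \<open>-1\<close>, and \<open>H\<close> is the affine group \<open>AGL(1, 5)\<close>, so \<open>L\<close> acts
  on the six cosets as \<open>PGL(2, 5)\<close> acts on the projective line. Contracting the orbits of \<open>M\<close>
  gives the complete graph \<open>K\<^sub>6\<close>, and the graph is the cover of \<open>K\<^sub>6\<close> with group \<open>\<int>\<^sub>p\<^sup>4\<close> that is
  given by an explicit table of voltages. This is lemma \<open>arcs_eq\<close>: a vertex is a pair
  \<open>V j x\<close> of a point \<open>j < 6\<close> and a vector \<open>x\<close> modulo \<open>p\<close>, and its neighbours are the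
  \<open>V k (x + voltage j k)\<close> with \<open>k \<noteq> j\<close>. The valency can be read off from this, connectivity
  holds because the voltages of triangles generate \<open>\<int>\<^sub>p\<^sup>4\<close>, and arc-transitivity is a property of
  every coset graph \<open>Cos(G, H, HxH)\<close> with an involution \<open>x\<close>. The automorphism \<open>\<alpha>\<close> of order 5
  is quasi-semiregular: it fixes one of the six points, and no non-zero vector.

  The main point is that there are no automorphisms besides the right multiplications. As
  \<open>G\<close> is transitive on 2-arcs (\<open>two_arc_transitive_at_base\<close>), it is enough that an automorphism
  fixing a 2-arc is the identity (\<open>rigid\<close>). The argument uses the 5-cycles. By inspection of
  the voltages, every 2-arc \<open>x, v, y\<close> of the graph extends in exactly one way to a 3-arc
  \<open>x, v, y, z\<close> on a 5-cycle (\<open>pentagon_at\<close>, \<open>pentagon_only\<close>). The condition \<open>p \<ge> 7\<close> enters here: the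
  integer vectors that have to be non-zero modulo \<open>p\<close> have small coordinates. Mapping \<open>x\<close> to
  \<open>z\<close>, and \<open>y\<close> to \<open>v\<close>, is a bijection from the neighbours of \<open>v\<close> to those of \<open>y\<close>, and every
  automorphism commutes with this parallel transport along arcs (\<open>local_perm_transport\<close>).

  Transport around a 5-cycle through \<open>v\<close> is a permutation of the neighbours of \<open>v\<close>, and it is
  not trivial. Let an automorphism fix \<open>v\<close> and two of its neighbours. Its action on the other
  three neighbours is compatible with the transport around all 5-cycles, and three 5-cycles are
  enough to exclude the five non-trivial permutations (\<open>holonomy\<close>, \<open>fixes_neighbours\<close>). An
  automorphism that fixes a vertex and all its neighbours fixes, by transport, all neighbours
  of these, hence everything by connectivity (\<open>fixes_spreads\<close>, \<open>nbr_induct\<close>).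

  Statements about permutations of five points, or about voltages, that concern finitely many
  cases are decided by rewriting; for this purpose permutations are also written as lists.
\<close>

section \<open>Semidirect products and prime orbits\<close>

lemma semidirect_product_group:
  assumes "group N" "group K"
    and hom: "\<And>k. k \<in> carrier K \<Longrightarrow> \<phi> k \<in> hom N N"
    and comp: "\<And>k l x. k \<in> carrier K \<Longrightarrow> l \<in> carrier K \<Longrightarrow> x \<in> carrier N \<Longrightarrow>
                 \<phi> (k \<otimes>\<^bsub>K\<^esub> l) x = \<phi> l (\<phi> k x)"
    and one: "\<And>x. x \<in> carrier N \<Longrightarrow> \<phi> \<one>\<^bsub>K\<^esub> x = x"
  shows "group (semidirect_product N K \<phi>)"
proof -
  interpret N: group N by fact
  interpret K: group K by fact
  have closed: "\<phi> k x \<in> carrier N" if "k \<in> carrier K" "x \<in> carrier N" for k x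
    using hom[OF that(1)] that(2) by (auto simp: hom_def)
  have mult: "\<phi> k (x \<otimes>\<^bsub>N\<^esub> y) = \<phi> k x \<otimes>\<^bsub>N\<^esub> \<phi> k y"
    if "k \<in> carrier K" "x \<in> carrier N" "y \<in> carrier N" for k x y
    using hom[OF that(1)] that(2,3) by (auto simp: hom_def)
  have one': "\<phi> k \<one>\<^bsub>N\<^esub> = \<one>\<^bsub>N\<^esub>" if "k \<in> carrier K" for k
    using hom[OF that] by (simp add: hom_one)
  show ?thesis
  proof (rule groupI)
    show "x \<otimes>\<^bsub>semidirect_product N K \<phi>\<^esub> y \<in> carrier (semidirect_product N K \<phi>)"
      if "x \<in> carrier (semidirect_product N K \<phi>)" "y \<in> carrier (semidirect_product N K \<phi>)" for x y
      using that by (auto simp: semidirect_product_def closed)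
    show "\<one>\<^bsub>semidirect_product N K \<phi>\<^esub> \<in> carrier (semidirect_product N K \<phi>)"
      by (simp add: semidirect_product_def)
    show "x \<otimes>\<^bsub>semidirect_product N K \<phi>\<^esub> y \<otimes>\<^bsub>semidirect_product N K \<phi>\<^esub> z
        = x \<otimes>\<^bsub>semidirect_product N K \<phi>\<^esub> (y \<otimes>\<^bsub>semidirect_product N K \<phi>\<^esub> z)"
      if "x \<in> carrier (semidirect_product N K \<phi>)" "y \<in> carrier (semidirect_product N K \<phi>)"
        "z \<in> carrier (semidirect_product N K \<phi>)" for x y z
      using that
      by (auto simp: semidirect_product_def closed mult comp N.m_assoc K.m_assoc K.inv_mult_group)
    show "\<one>\<^bsub>semidirect_product N K \<phi>\<^esub> \<otimes>\<^bsub>semidirect_product N K \<phi>\<^esub> x = x"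
      if "x \<in> carrier (semidirect_product N K \<phi>)" for x
      using that by (auto simp: semidirect_product_def one)
    show "\<exists>y\<in>carrier (semidirect_product N K \<phi>).
        y \<otimes>\<^bsub>semidirect_product N K \<phi>\<^esub> x = \<one>\<^bsub>semidirect_product N K \<phi>\<^esub>"
      if xin: "x \<in> carrier (semidirect_product N K \<phi>)" for x
    proof -
      obtain n k where x: "x = (n, k)" "n \<in> carrier N" "k \<in> carrier K"
        using xin by (auto simp: semidirect_product_def)
      then show ?thesis
        by (intro bexI[of _ "(\<phi> k (inv\<^bsub>N\<^esub> n), inv\<^bsub>K\<^esub> k)"])
           (simp_all add: semidirect_product_def closed mult[symmetric] one')
    qed
  qed
qed

text \<open>For automorphisms that act on the right and are composed from left to right.\<close>

lemma opposite_group: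
  assumes "group A"
  shows "group (A \<lparr>mult := (\<lambda>f g. g \<otimes>\<^bsub>A\<^esub> f)\<rparr>)"
proof -
  interpret group A by fact
  show ?thesis
  proof (rule groupI)
    fix f assume "f \<in> carrier (A\<lparr>mult := (\<lambda>f g. g \<otimes>\<^bsub>A\<^esub> f)\<rparr>)"
    then show "\<exists>g\<in>carrier (A\<lparr>mult := (\<lambda>f g. g \<otimes>\<^bsub>A\<^esub> f)\<rparr>).
        g \<otimes>\<^bsub>A\<lparr>mult := (\<lambda>f g. g \<otimes>\<^bsub>A\<^esub> f)\<rparr>\<^esub> f = \<one>\<^bsub>A\<lparr>mult := (\<lambda>f g. g \<otimes>\<^bsub>A\<^esub> f)\<rparr>\<^esub>"
      by (intro bexI[of _ "inv\<^bsub>A\<^esub> f"]) auto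
  qed (auto simp: m_assoc)
qed

text \<open>
  The length of a cycle divides every period; a period that is prime leaves only the length 1.
\<close>

lemma card_orbit_prime:
  assumes q: "prime (q::nat)" "(f ^^ q) s = s" and "f s \<noteq> s"
  shows "card (orbit f s) = q"
proof -
  have mult: "(f ^^ (k * n)) s = s" if "(f ^^ k) s = s" for k n
    by (induction n) (simp_all add: that funpow_add)
  have period: "q dvd k" if k: "(f ^^ k) s = s" for k
  proof (rule ccontr)
    assume "\<not> q dvd k"
    then have cop: "coprime k q" using prime_imp_coprime[OF q(1)] coprime_commute by blast
    have "k \<noteq> 0" using \<open>\<not> q dvd k\<close> by (intro notI) simp
    then obtain m n where "k * m = q * n + 1"
      using bezout_nat[of k q] cop by (auto simp: coprime_iff_gcd_eq_1)
    then have "s = (f ^^ (q * n + 1)) s" using mult[OF k, of m] by simp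
    also have "\<dots> = f s" using mult[OF q(2), of n] by (simp only: Suc_eq_plus1[symmetric] funpow.simps o_apply)
    finally show False using \<open>f s \<noteq> s\<close> by simp
  qed
  have inj: "inj_on (\<lambda>n. (f ^^ n) s) {..<q}"
  proof (rule linorder_inj_onI)
    fix m n assume mn: "m < n" "m \<in> {..<q}" "n \<in> {..<q}"
    show "(f ^^ m) s \<noteq> (f ^^ n) s"
    proof
      assume eq: "(f ^^ m) s = (f ^^ n) s"
      have "s = (f ^^ (q - m + m)) s" using mn q(2) by simp
      also have "\<dots> = (f ^^ (q - m)) ((f ^^ m) s)" by (simp only: funpow_add o_apply)
      also have "\<dots> = (f ^^ (q - m + n)) s" by (simp only: eq funpow_add o_apply)
      also have "q - m + n = (n - m) + q" using mn by simp
      also have "(f ^^ (n - m + q)) s = (f ^^ (n - m)) s" by (simp only: funpow_add o_apply q(2))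
      finally have "q dvd n - m" using period by simp
      then show False using mn by (auto dest!: dvd_imp_le)
    qed
  qed auto
  have "orbit f s = (\<lambda>n. (f ^^ n) s) ` {..<q}"
    using orbit_altdef_bounded[OF q(2) prime_gt_0_nat[OF q(1)]] by auto
  then show ?thesis using card_image[OF inj] by simp
qed

section \<open>Coset graphs of involutions\<close>

text \<open>
  For an involution \<open>x\<close> the double coset \<open>HxH\<close> is closed under inverses, and the edges have a
  simple description that makes arc-transitivity evident.
\<close>

locale involution_coset_graph = group G for G (structure) +
  fixes H :: "'a set" and x :: 'a
  assumes H: "subgroup H G" and x: "x \<in> carrier G" "x \<notin> H" and xx: "x \<otimes> x = \<one>"
begin

abbreviation "X \<equiv> coset_graph G H (double_coset G H x)"

definition translate :: "'a \<Rightarrow> 'a set \<Rightarrow> 'a set" where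
  "translate g = restrict (\<lambda>U. U #> g) (rcosets H)"

lemma H_sub: "H \<subseteq> carrier G"
  using subgroup.subset[OF H] .

lemma coset_absorb: "h \<in> H \<Longrightarrow> g \<in> carrier G \<Longrightarrow> H #> (h \<otimes> g) = H #> g"
  using coset_mult_assoc[OF H_sub, of h g] H_sub coset_join2[OF _ H] by (metis subsetD)

lemma in_rcosets: "g \<in> carrier G \<Longrightarrow> H #> g \<in> rcosets H"
  by (auto simp: RCOSETS_def)

lemma rcosets_cases:
  assumes "U \<in> rcosets H"
  obtains g where "g \<in> carrier G" "U = H #> g"
  using assms by (auto simp: RCOSETS_def)

lemma pverts_X [simp]: "pverts X = rcosets H"
  by (simp add: coset_graph_def)

text \<open>
  An element \<open>hxk\<close> of \<open>HxH\<close> joins \<open>Hg\<close> to \<open>Hxkg\<close>, and \<open>Hg = Hkg\<close>; so \<open>g\<close> can be replaced by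
  \<open>kg\<close> and \<open>hxk\<close> by \<open>x\<close>. The reverse of the arc of \<open>g\<close> is the arc of \<open>xg\<close>.
\<close>

lemma parcs_X: "parcs X = {(H #> g, H #> (x \<otimes> g)) | g. g \<in> carrier G}"
proof (intro equalityI subsetI)
  fix a assume "a \<in> parcs X"
  then obtain U W g y where a: "a = (U, W)" and g: "g \<in> carrier G" and y: "y \<in> double_coset G H x"
    and UW: "{U, W} = {H #> g, H #> (y \<otimes> g)}"
    by (auto simp: coset_graph_def coset_graph_edges_def)
  obtain h k where hk: "h \<in> H" "k \<in> H" "y = h \<otimes> x \<otimes> k"
    using y by (auto simp: double_coset_def set_mult_def r_coset_def)
  have hkG: "h \<in> carrier G" "k \<in> carrier G" using hk H_sub by auto
  define g' where "g' = k \<otimes> g"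
  have g': "g' \<in> carrier G" using hkG g by (simp add: g'_def)
  have 1: "H #> g = H #> g'" using coset_absorb[OF hk(2) g] by (simp add: g'_def)
  have "y \<otimes> g = h \<otimes> (x \<otimes> g')" using hkG x g by (simp add: hk(3) g'_def m_assoc)
  then have 2: "H #> (y \<otimes> g) = H #> (x \<otimes> g')" using coset_absorb[OF hk(1), of "x \<otimes> g'"] x g' by simp
  have 3: "x \<otimes> (x \<otimes> g') = g'" using x g' xx by (simp flip: m_assoc)
  have "(U = H #> g' \<and> W = H #> (x \<otimes> g')) \<or> (U = H #> (x \<otimes> g') \<and> W = H #> (x \<otimes> (x \<otimes> g')))"
    using UW unfolding 1 2 3 by (auto simp: doubleton_eq_iff)
  then show "a \<in> {(H #> g, H #> (x \<otimes> g)) | g. g \<in> carrier G}"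
    using a g' x by blast
next
  fix a assume "a \<in> {(H #> g, H #> (x \<otimes> g)) | g. g \<in> carrier G}"
  then obtain g where a: "a = (H #> g, H #> (x \<otimes> g))" and g: "g \<in> carrier G" by blast
  have one: "\<one> \<in> H" using subgroup.one_closed[OF H] .
  have "\<one> \<otimes> x \<otimes> \<one> \<in> double_coset G H x"
    unfolding double_coset_def set_mult_def r_coset_def using one by blast
  then have "x \<in> double_coset G H x" using x by simp
  then show "a \<in> parcs X"
    using g by (auto simp: a coset_graph_def coset_graph_edges_def)
qed

lemma arc_not_loop: "g \<in> carrier G \<Longrightarrow> H #> g \<noteq> H #> (x \<otimes> g)"
proof
  assume g: "g \<in> carrier G" and eq: "H #> g = H #> (x \<otimes> g)"
  have "x \<otimes> g \<in> H #> g"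
    unfolding eq using rcos_self[OF _ H] x g by simp
  then obtain h where "h \<in> H" "x \<otimes> g = h \<otimes> g" by (auto simp: r_coset_def)
  then have "x = h" using x g H_sub by (metis right_cancel subsetD)
  then show False using x \<open>h \<in> H\<close> by simp
qed

lemma pair_graph_X:
  assumes "finite (carrier G)"
  shows "pair_graph X"
proof
  have fin: "finite (rcosets H)"
    using assms by (simp add: RCOSETS_def)
  show "finite (pverts X)" using fin by simp
  show "fst e \<in> pverts X" "snd e \<in> pverts X" if "e \<in> parcs X" for e
    using that x by (auto simp: parcs_X in_rcosets)
  then have "parcs X \<subseteq> (rcosets H) \<times> (rcosets H)" by (fastforce simp: mem_Times_iff)
  then show "finite (parcs X)" using fin by (meson finite_SigmaI finite_subset)
  show "fst e \<noteq> snd e" if "e \<in> parcs X" for e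
    using that arc_not_loop by (auto simp: parcs_X)
  show "symmetric X"
    unfolding symmetric_def by (auto simp: sym_def coset_graph_def insert_commute)
qed

lemma translate_coset:
  "g \<in> carrier G \<Longrightarrow> h \<in> carrier G \<Longrightarrow> translate h (H #> g) = H #> (g \<otimes> h)"
  by (simp add: translate_def in_rcosets coset_mult_assoc[OF H_sub])

lemma translate_mult:
  assumes "g \<in> carrier G" "h \<in> carrier G" "U \<in> rcosets H"
  shows "translate h (translate g U) = translate (g \<otimes> h) U"
  using assms by (auto elim!: rcosets_cases simp: translate_coset m_assoc)

lemma translate_closed: "g \<in> carrier G \<Longrightarrow> U \<in> rcosets H \<Longrightarrow> translate g U \<in> rcosets H"
  by (auto elim!: rcosets_cases simp: translate_coset in_rcosets)

lemma translate_one: "U \<in> rcosets H \<Longrightarrow> translate \<one> U = U"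
  by (auto elim!: rcosets_cases simp: translate_coset)

lemma translate_arc:
  assumes "g \<in> carrier G" "(U, W) \<in> parcs X"
  shows "(translate g U, translate g W) \<in> parcs X"
proof -
  obtain h where "h \<in> carrier G" "U = H #> h" "W = H #> (x \<otimes> h)"
    using assms(2) by (auto simp: parcs_X)
  then show ?thesis using assms(1) x by (auto simp: parcs_X translate_coset m_assoc)
qed

lemma translate_aut:
  assumes g: "g \<in> carrier G"
  shows "translate g \<in> graph_auts X"
proof -
  have cancel: "translate (inv g) (translate g U) = U" "translate g (translate (inv g) U) = U"
    if "U \<in> rcosets H" for U
    using that g by (simp_all add: translate_mult translate_one)
  have "bij_betw (translate g) (rcosets H) (rcosets H)"
    by (rule bij_betwI[where g = "translate (inv g)"]) (use g in \<open>auto simp: cancel translate_closed\<close>)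
  then have "translate g \<in> Bij (pverts X)"
    by (simp add: Bij_def translate_def)
  moreover have "(translate g U, translate g W) \<in> parcs X \<longleftrightarrow> (U, W) \<in> parcs X"
    if "U \<in> rcosets H" "W \<in> rcosets H" for U W
    using translate_arc[OF g, of U W] translate_arc[of "inv g" "translate g U" "translate g W"] g that
    by (auto simp: cancel)
  ultimately show ?thesis by (simp add: graph_auts_def)
qed

lemma arc_transitive:
  assumes "(U, W) \<in> parcs X" "(U', W') \<in> parcs X"
  obtains g where "g \<in> carrier G" "translate g U = U'" "translate g W = W'"
proof -
  obtain h h' where h: "h \<in> carrier G" "U = H #> h" "W = H #> (x \<otimes> h)"
    and h': "h' \<in> carrier G" "U' = H #> h'" "W' = H #> (x \<otimes> h')"
    using assms by (auto simp: parcs_X)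
  have "h \<otimes> (inv h \<otimes> h') = h'" "x \<otimes> h \<otimes> (inv h \<otimes> h') = x \<otimes> h'"
    using h(1) h'(1) x by (simp_all add: m_assoc flip: m_assoc[of h "inv h" h'])
  then show thesis
    using h h' x by (intro that[of "inv h \<otimes> h'"]) (simp_all add: translate_coset)
qed

lemma symmetric_graph_X: "symmetric_graph X"
  unfolding symmetric_graph_def
proof (intro conjI; clarify)
  fix U W assume "U \<in> pverts X" "W \<in> pverts X"
  then obtain g h where g: "g \<in> carrier G" "U = H #> g" and h: "h \<in> carrier G" "W = H #> h"
    by (auto simp: RCOSETS_def)
  then have "translate (inv g \<otimes> h) U = W"
    by (simp add: translate_coset inv_solve_left' flip: m_assoc)
  then show "\<exists>f\<in>graph_auts X. f U = W"
    using g(1) h(1) by (intro bexI[of _ "translate (inv g \<otimes> h)"] translate_aut) simp_all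
next
  show "\<exists>f\<in>graph_auts X. f U = U' \<and> f W = W'"
    if arcs: "(U, W) \<in> parcs X" "(U', W') \<in> parcs X" for U W U' W'
  proof -
    obtain g where g: "g \<in> carrier G" "translate g U = U'" "translate g W = W'"
      using arc_transitive[OF arcs] .
    then show ?thesis by (auto intro!: bexI[of _ "translate g"] translate_aut)
  qed
qed

text \<open>
  Automorphisms of the graph are composed from right to left, while translations by \<open>g\<close> and
  then by \<open>h\<close> give the translation by \<open>gh\<close>. The inverse compensates for this.
\<close>

lemma iso_graph_aut_group:
  assumes all: "\<And>f. f \<in> graph_auts X \<Longrightarrow> \<exists>g \<in> carrier G. \<forall>U \<in> rcosets H. f U = translate g U"
    and faithful: "\<And>g. g \<in> carrier G \<Longrightarrow> \<forall>U \<in> rcosets H. translate g U = U \<Longrightarrow> g = \<one>"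
  shows "(\<lambda>g. translate (inv g)) \<in> iso G (graph_aut_group X)"
proof -
  have sub: "translate g \<in> Bij (rcosets H)" if "g \<in> carrier G" for g
    using translate_aut[OF that] by (simp add: graph_auts_def)
  have mult: "translate (inv (g \<otimes> h)) = compose (rcosets H) (translate (inv g)) (translate (inv h))"
    if "g \<in> carrier G" "h \<in> carrier G" for g h
  proof
    fix U
    show "translate (inv (g \<otimes> h)) U = compose (rcosets H) (translate (inv g)) (translate (inv h)) U"
      using that by (cases "U \<in> rcosets H")
        (simp_all add: compose_def inv_mult_group translate_mult, simp add: translate_def)
  qed
  have "(\<lambda>g. translate (inv g)) \<in> hom G (graph_aut_group X)"
    using sub by (auto simp: hom_def graph_aut_group_def BijGroup_def translate_aut mult)
  moreover have "inj_on (\<lambda>g. translate (inv g)) (carrier G)"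
  proof (rule inj_onI)
    fix g h assume g: "g \<in> carrier G" and h: "h \<in> carrier G" and eq: "translate (inv g) = translate (inv h)"
    have "translate (inv g \<otimes> h) U = U" if "U \<in> rcosets H" for U
      using translate_mult[of "inv g" h U] translate_mult[of "inv h" h U] g h that eq
      by (simp add: translate_one)
    then have "inv g \<otimes> h = \<one>" using faithful g h by simp
    then show "g = h" using g h by (metis inv_equality inv_inv inv_closed)
  qed
  moreover have "graph_auts X \<subseteq> (\<lambda>g. translate (inv g)) ` carrier G"
  proof
    fix f assume f: "f \<in> graph_auts X"
    then obtain g where g: "g \<in> carrier G" "\<forall>U \<in> rcosets H. f U = translate g U" using all by blast
    have "f \<in> extensional (rcosets H)" using f by (simp add: graph_auts_def Bij_def)
    then have "f = translate g"
      using g(2) by (intro extensionalityI[of _ "rcosets H"]) (auto simp: translate_def)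
    then show "f \<in> (\<lambda>g. translate (inv g)) ` carrier G"
      using g(1) by (intro image_eqI[of _ _ "inv g"]) auto
  qed
  ultimately show ?thesis
    by (auto simp: iso_def bij_betw_def graph_aut_group_def translate_aut)
qed

end

section \<open>Linear algebra of M\<close>

declare One_nat_def [simp del]

text \<open>
  As \<open>abcde = 1\<close>, the group \<open>M\<close> is \<open>\<int>\<^sub>p\<^sup>5\<close> modulo the diagonal, and permutations of \<open>\<Delta>\<close> permute the
  five coordinates. The quadruple \<open>(i, j, k, l)\<close> represents the class of \<open>(i, j, k, l, 0)\<close>.
\<close>

definition coord :: "vec4 \<Rightarrow> nat \<Rightarrow> int" where
  "coord = (\<lambda>(i, j, k, l) t. if t = 1 then i else if t = 2 then j else if t = 3 then k
                            else if t = 4 then l else 0)"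

text \<open>
  The action of \<open>\<sigma>\<close> on integer vectors: permute the five coordinates, subtract the fifth from
  all of them to return to a quadruple, and change the sign if \<open>\<sigma>\<close> is odd. Coordinate \<open>t\<close> of the
  image comes from coordinate \<open>\<sigma> t\<close>, so the generator with number \<open>\<sigma> t\<close> goes to the one with
  number \<open>t\<close>, or to its inverse. With this choice \<open>\<sigma> \<circ> \<tau>\<close> acts as \<open>\<sigma>\<close> followed by \<open>\<tau>\<close>, as needed for a right
  action.
\<close>

definition lam :: "(nat \<Rightarrow> nat) \<Rightarrow> vec4 \<Rightarrow> vec4" where
  "lam \<sigma> x = (sign \<sigma> * (coord x (\<sigma> 1) - coord x (\<sigma> 5)), sign \<sigma> * (coord x (\<sigma> 2) - coord x (\<sigma> 5)),
              sign \<sigma> * (coord x (\<sigma> 3) - coord x (\<sigma> 5)), sign \<sigma> * (coord x (\<sigma> 4) - coord x (\<sigma> 5)))"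

definition red :: "nat \<Rightarrow> vec4 \<Rightarrow> vec4" where
  "red p = (\<lambda>(i, j, k, l). (i mod int p, j mod int p, k mod int p, l mod int p))"

definition Lam :: "nat \<Rightarrow> (nat \<Rightarrow> nat) \<Rightarrow> vec4 \<Rightarrow> vec4" where
  "Lam p \<sigma> = restrict (\<lambda>x. red p (lam \<sigma> x)) (carrier (grpM p))"

lemma red_red [simp]: "red p (red p x) = red p x"
  by (cases x) (simp add: red_def)

lemma red_add_left [simp]: "red p (red p x + y) = red p (x + y)"
  by (cases x; cases y) (simp add: red_def mod_simps)

lemma red_add_right [simp]: "red p (x + red p y) = red p (x + y)"
  by (cases x; cases y) (simp add: red_def mod_simps)

lemma red_minus [simp]: "red p (- red p x) = red p (- x)"
  by (cases x) (simp add: red_def mod_minus_eq)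

lemma red_add_cong: "red p x = red p x' \<Longrightarrow> red p y = red p y' \<Longrightarrow> red p (x + y) = red p (x' + y')"
  by (metis red_add_left red_add_right)

lemma carrier_M: "p > 0 \<Longrightarrow> carrier (grpM p) = {x. red p x = x}"
  by (auto simp: grpM_def carrier_integer_mod_group red_def mod_pos_pos_trivial)
     (metis of_nat_0_less_iff pos_mod_sign pos_mod_bound)+

lemma red_in_M [simp, intro]: "p > 0 \<Longrightarrow> red p x \<in> carrier (grpM p)"
  by (simp add: carrier_M)

lemma mult_M [simp]: "x \<otimes>\<^bsub>grpM p\<^esub> y = red p (x + y)"
  by (cases x; cases y) (simp add: grpM_def red_def)

lemma one_M [simp]: "\<one>\<^bsub>grpM p\<^esub> = 0"
  by (simp add: grpM_def zero_prod_def)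

lemma group_M [simp]: "group (grpM p)"
  by (simp add: grpM_def DirProd_group)

lemma zero_in_M [simp]: "0 \<in> carrier (grpM p)"
  using group.is_monoid[OF group_M[of p]] monoid.one_closed by fastforce

lemma red_carrier: "p > 0 \<Longrightarrow> x \<in> carrier (grpM p) \<Longrightarrow> red p x = x"
  by (simp add: carrier_M)

lemma red_0 [simp]: "red p 0 = 0"
  by (simp add: red_def zero_prod_def)

lemma inv_M [simp]:
  assumes "p > 0" "x \<in> carrier (grpM p)"
  shows "inv\<^bsub>grpM p\<^esub> x = red p (- x)"
  by (rule group.inv_equality[OF group_M]) (use assms in auto)

definition scale :: "int \<Rightarrow> vec4 \<Rightarrow> vec4" where
  "scale n = (\<lambda>(i, j, k, l). (n * i, n * j, n * k, n * l))"

lemma red_scale: "red p (scale n (red p x)) = red p (scale n x)"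
  by (cases x) (simp add: red_def scale_def mod_simps)

lemma nat_pow_M:
  assumes "p > 0" "x \<in> carrier (grpM p)"
  shows "x [^]\<^bsub>grpM p\<^esub> n = red p (scale (int n) x)"
proof (induction n)
  case 0
  then show ?case by (cases x) (simp add: scale_def zero_prod_def[symmetric] red_0[unfolded zero_prod_def])
next
  case (Suc n)
  have "scale (int (Suc n)) x = scale (int n) x + x"
    by (cases x) (simp add: scale_def algebra_simps)
  with Suc show ?case by simp
qed

lemma int_pow_M:
  assumes "p > 0" "x \<in> carrier (grpM p)"
  shows "x [^]\<^bsub>grpM p\<^esub> (n::int) = red p (scale n x)"
proof -
  have "- scale (- n) x = scale n x" by (cases x) (simp add: scale_def)
  moreover have "x [^]\<^bsub>grpM p\<^esub> n
      = (if n < 0 then inv\<^bsub>grpM p\<^esub> (x [^]\<^bsub>grpM p\<^esub> nat (- n)) else x [^]\<^bsub>grpM p\<^esub> nat n)"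
    by (rule int_pow_def2)
  ultimately show ?thesis
    by (simp only: nat_pow_M[OF assms] inv_M[OF assms(1)] red_in_M[OF assms(1)] red_minus split: if_split) auto
qed

lemma coord_eqI:
  assumes "\<And>t. t \<in> {1..4} \<Longrightarrow> coord x t = coord y t"
  shows "x = y"
  using assms[of 1] assms[of 2] assms[of 3] assms[of 4]
  by (cases x; cases y) (simp add: coord_def)

lemma coord_add: "coord (x + y) t = coord x t + coord y t"
  by (cases x; cases y) (simp add: coord_def)

lemma coord_0 [simp]: "coord 0 t = 0"
  by (simp add: coord_def zero_prod_def)

lemma lam_add: "lam \<sigma> (x + y) = lam \<sigma> x + lam \<sigma> y"
  by (simp add: lam_def coord_add algebra_simps)

lemma lam_0 [simp]: "lam \<sigma> 0 = 0"
  by (simp add: lam_def) (simp add: zero_prod_def)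

lemma red_lam [simp]: "red p (lam \<sigma> (red p x)) = red p (lam \<sigma> x)"
proof -
  have c: "coord (red p x) t = coord x t mod int p" for t
    by (cases x) (simp add: coord_def red_def)
  have m: "(s * (a mod q - b mod q)) mod q = (s * (a - b)) mod q" for s a b q :: int
    by (metis mod_diff_eq mod_mult_right_eq)
  have r: "red p (i, j, k, l) = (i mod int p, j mod int p, k mod int p, l mod int p)" for i j k l
    by (simp add: red_def)
  show ?thesis by (simp only: lam_def r c m)
qed

lemma coord_lam:
  assumes "t \<in> {1..5}"
  shows "coord (lam \<sigma> x) t = sign \<sigma> * (coord x (\<sigma> t) - coord x (\<sigma> 5))"
proof -
  have "t = 1 \<or> t = 2 \<or> t = 3 \<or> t = 4 \<or> t = 5" using assms by (auto simp: numeral_eq_Suc le_Suc_eq)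
  then show ?thesis by (elim disjE) (simp_all add: lam_def coord_def)
qed

lemma sign_comp_permutes:
  assumes "\<sigma> permutes {1..5::nat}" "\<tau> permutes {1..5}"
  shows "sign (\<sigma> \<circ> \<tau>) = sign \<sigma> * sign \<tau>"
  using assms by (meson finite_atLeastAtMost permutation_permutes sign_compose)

lemma lam_comp:
  assumes "\<sigma> permutes {1..5}" "\<tau> permutes {1..5}"
  shows "lam (\<sigma> \<circ> \<tau>) x = lam \<tau> (lam \<sigma> x)"
proof (rule coord_eqI)
  fix t :: nat assume "t \<in> {1..4}"
  then have t: "t \<in> {1..5}" by auto
  have "\<tau> t \<in> {1..5}" "\<tau> 5 \<in> {1..5}"
    using t permutes_in_image[OF assms(2)] by auto
  then show "coord (lam (\<sigma> \<circ> \<tau>) x) t = coord (lam \<tau> (lam \<sigma> x)) t"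
    using t by (simp add: coord_lam sign_comp_permutes[OF assms] algebra_simps del: o_apply)
      (simp add: algebra_simps)
qed

lemma lam_id [simp]: "lam id x = x"
  by (cases x) (simp add: lam_def coord_def)

lemma Lam_apply: "x \<in> carrier (grpM p) \<Longrightarrow> Lam p \<sigma> x = red p (lam \<sigma> x)"
  by (simp add: Lam_def)

lemma Lam_comp:
  assumes "p > 0" "\<sigma> permutes {1..5}" "\<tau> permutes {1..5}"
  shows "Lam p (\<sigma> \<circ> \<tau>) = compose (carrier (grpM p)) (Lam p \<tau>) (Lam p \<sigma>)"
  by (rule ext) (use assms in \<open>auto simp: Lam_def compose_def lam_comp\<close>)

lemma Lam_id: "p > 0 \<Longrightarrow> Lam p id = (\<lambda>x \<in> carrier (grpM p). x)"
  by (rule ext) (auto simp: Lam_def red_carrier)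

lemma Lam_auto:
  assumes "p > 0" "\<sigma> permutes {1..5}"
  shows "Lam p \<sigma> \<in> auto (grpM p)"
proof -
  have hom: "Lam p \<sigma> \<in> hom (grpM p) (grpM p)"
    using assms by (auto simp: hom_def Lam_def lam_add)
  have cancel: "lam \<tau> (lam \<rho> x) = x"
    if "\<rho> permutes {1..5}" "\<tau> permutes {1..5}" "\<rho> \<circ> \<tau> = id" for \<rho> \<tau> x
    using lam_comp[OF that(1,2)] that(3) by (metis lam_id)
  have "bij_betw (Lam p \<sigma>) (carrier (grpM p)) (carrier (grpM p))"
    by (rule bij_betwI[where g = "Lam p (inv' \<sigma>)"])
       (use assms permutes_inv[OF assms(2)] permutes_inv_o[OF assms(2)] in
         \<open>auto simp: cancel Lam_apply red_carrier\<close>)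
  with hom show ?thesis by (auto simp: auto_def Bij_def Lam_def)
qed

section \<open>Permutations of five points as words\<close>

text \<open>The list of values represents a permutation of \<open>{1..5}\<close> in computations.\<close>

definition vals :: "(nat \<Rightarrow> nat) \<Rightarrow> nat list" where
  "vals \<sigma> = map \<sigma> [1, 2, 3, 4, 5]"

definition perm_of :: "nat list \<Rightarrow> nat \<Rightarrow> nat" where
  "perm_of xs t = (if t \<in> {1..5} then xs ! (t - 1) else t)"

abbreviation words :: "nat list set" where
  "words \<equiv> permutations_of_set {1, 2, 3, 4, 5}"

fun inversion_sign :: "nat list \<Rightarrow> int" where
  "inversion_sign [] = 1"
| "inversion_sign (x # xs) = prod_list (map (\<lambda>y. if y < x then - 1 else 1) xs) * inversion_sign xs"

lemma five_eq: "{1..5::nat} = {1, 2, 3, 4, 5}"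
  by auto

lemma in_five: "t \<in> {1..5::nat} \<longleftrightarrow> t = 1 \<or> t = 2 \<or> t = 3 \<or> t = 4 \<or> t = 5"
  unfolding five_eq by simp

lemma vals_in_words:
  assumes "\<sigma> permutes {1..5}"
  shows "vals \<sigma> \<in> words"
proof -
  have "\<sigma> ` {1..5} = {1..5}" "inj \<sigma>"
    using assms by (auto simp: permutes_image permutes_inj)
  then show ?thesis
    unfolding five_eq by (auto simp: permutations_of_set_def vals_def inj_eq)
qed

lemma perm_of_vals [simp]: "\<sigma> permutes {1..5} \<Longrightarrow> perm_of (vals \<sigma>) = \<sigma>"
  by (rule ext) (auto simp: perm_of_def vals_def in_five permutes_not_in[of \<sigma> "{1..5}"]
      simp del: atLeastAtMost_iff)

lemma words_length: "xs \<in> words \<Longrightarrow> length xs = 5"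
  using distinct_card by (fastforce simp: permutations_of_set_def)

lemma vals_perm_of [simp]:
  assumes "length xs = 5"
  shows "vals (perm_of xs) = xs"
proof -
  obtain a b c d e where "xs = [a, b, c, d, e]"
    using assms by (auto simp: numeral_eq_Suc length_Suc_conv)
  then show ?thesis by (simp add: vals_def perm_of_def)
qed

lemma perm_of_permutes:
  assumes "xs \<in> words"
  shows "perm_of xs permutes {1..5}"
proof (rule bij_imp_permutes)
  have "length xs = 5" by (rule words_length[OF assms])
  then obtain a b c d e where xs: "xs = [a, b, c, d, e]"
    by (auto simp: numeral_eq_Suc length_Suc_conv)
  have "distinct [a, b, c, d, e]" "set [a, b, c, d, e] = {1..5}"
    using assms unfolding five_eq xs by (simp_all add: permutations_of_set_def)
  moreover have "perm_of xs ` {1..5} = {a, b, c, d, e}" "inj_on (perm_of xs) {1..5} \<longleftrightarrow> distinct [a, b, c, d, e]"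
    unfolding five_eq by (auto simp: perm_of_def xs inj_on_def)
  ultimately show "bij_betw (perm_of xs) {1..5} {1..5}"
    by (simp add: bij_betw_def)
qed (auto simp: perm_of_def)

lemma vals_comp: "vals (\<sigma> \<circ> \<tau>) = map \<sigma> (vals \<tau>)"
  by (simp add: vals_def)

lemma transpose_flips_inversion_sign:
  "\<forall>xs \<in> words. \<forall>a \<in> set [1, 2, 3, 4, 5]. \<forall>b \<in> set [1, 2, 3, 4, 5]. a < b \<longrightarrow>
     inversion_sign (map (Transposition.transpose a b) xs) = - inversion_sign xs"
  by code_simp

text \<open>Both sides change sign under composition with a transposition.\<close>

lemma sign_eq_inversion_sign:
  assumes "\<sigma> permutes {1..5}"
  shows "sign \<sigma> = inversion_sign (vals \<sigma>)"
  using assms finite_atLeastAtMost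
proof (induction \<sigma> rule: permutes_induct)
  case id
  then show ?case by (simp add: vals_def)
next
  case (swap a b \<sigma>)
  have ab: "a \<in> set [1, 2, 3, 4, 5]" "b \<in> set [1, 2, 3, 4, 5]"
    using swap.hyps(1,2) unfolding in_five by simp_all
  have w: "vals \<sigma> \<in> words" by (rule vals_in_words[OF \<open>\<sigma> permutes {1..5}\<close>])
  have "inversion_sign (map (Transposition.transpose a b) (vals \<sigma>)) = - inversion_sign (vals \<sigma>)"
  proof (cases "a < b")
    case True
    then show ?thesis
      using transpose_flips_inversion_sign[rule_format, OF w ab] by blast
  next
    case False
    then have "b < a" using swap.hyps by simp
    then show ?thesis
      using transpose_flips_inversion_sign[rule_format, OF w ab(2,1)] by (simp add: transpose_commute[of a b])
  qed
  moreover have "sign (Transposition.transpose a b \<circ> \<sigma>) = - sign \<sigma>"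
    using sign_comp_permutes[OF permutes_swap_id \<open>\<sigma> permutes {1..5}\<close>, of a b] swap.hyps
    by (simp add: sign_swap_id)
  ultimately show ?case using swap.IH by (simp only: vals_comp)
qed

definition lam_word :: "nat list \<Rightarrow> vec4 \<Rightarrow> vec4" where
  "lam_word xs x = (let s = inversion_sign xs; c = (\<lambda>t. s * (coord x (xs ! t) - coord x (xs ! 4)))
                    in (c 0, c 1, c 2, c 3))"

lemma lam_eq_lam_word: "\<sigma> permutes {1..5} \<Longrightarrow> lam \<sigma> x = lam_word (vals \<sigma>) x"
  by (simp add: lam_def lam_word_def sign_eq_inversion_sign Let_def) (simp add: vals_def)

section \<open>The six points\<close>

text \<open>
  The group \<open>H\<close> consists of the affine maps modulo 5, which are sharply 2-transitive. So the
  coset of \<open>\<sigma>\<close> contains exactly one permutation that fixes 1 and 2, namely \<open>\<sigma>\<close> followed by the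
  affine map \<open>y \<mapsto> (y - \<sigma> 1) / (\<sigma> 2 - \<sigma> 1) + 1\<close>. The third power replaces the inverse, since
  \<open>b\<^sup>4 = 1\<close> modulo 5.
\<close>

definition normal_form :: "nat list \<Rightarrow> int list" where
  "normal_form xs = (let ys = map int xs; b = (ys ! 1 - ys ! 0) ^ 3
                     in map (\<lambda>y. ((y - ys ! 0) * b) mod 5 + 1) ys)"

definition reps :: "nat list list" where
  "reps = [[1,2,3,4,5], [1,2,3,5,4], [1,2,4,3,5], [1,2,4,5,3], [1,2,5,3,4], [1,2,5,4,3]]"

text \<open>
  Cosets of \<open>H\<close> in \<open>S\<^sub>5\<close> are numbered by the position of their representative in \<open>reps\<close>.
\<close>

definition point :: "nat list \<Rightarrow> nat" where
  "point xs = length (takeWhile (\<lambda>r. map int r \<noteq> normal_form xs) reps)"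

definition word_alpha :: "nat list" where "word_alpha = [5, 1, 2, 3, 4]"
definition word_beta :: "nat list" where "word_beta = [3, 1, 4, 2, 5]"
definition word_gamma :: "nat list" where "word_gamma = [2, 1, 4, 3, 5]"

abbreviation act :: "nat list \<Rightarrow> nat list \<Rightarrow> nat list" where
  "act h xs \<equiv> map (perm_of h) xs"

definition affine :: "nat \<Rightarrow> nat \<Rightarrow> nat list \<Rightarrow> nat list" where
  "affine i k xs = (act word_alpha ^^ i) ((act word_beta ^^ k) xs)"

text \<open>
  The table gives the vector \<open>voltage j k\<close> by which the neighbour over \<open>k\<close> of a vertex over \<open>j\<close>
  is translated. Each entry off the diagonal is an image of \<open>u\<^sup>2 = (2, -2, -2, 2)\<close> under \<open>L\<close>.
\<close>

definition voltage :: "nat \<Rightarrow> nat \<Rightarrow> vec4" where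
  "voltage j k =
  ([[(0, 0, 0, 0), (4, 2, 4, 0), (-2, 0, -4, -4), (2, -2, -2, 2), (0, 4, 2, 4), (-4, -4, 0, -2)],
   [(-4, -2, -4, 0), (0, 0, 0, 0), (0, 4, 4, 2), (-2, -4, 0, -4), (2, 2, -2, -2), (4, 0, 2, 4)],
   [(2, 0, 4, 4), (0, -4, -4, -2), (0, 0, 0, 0), (4, 4, 2, 0), (-4, -2, 0, -4), (-2, 2, -2, 2)],
   [(-2, 2, 2, -2), (2, 4, 0, 4), (-4, -4, -2, 0), (0, 0, 0, 0), (4, 0, 4, 2), (0, -2, -4, -4)],
   [(0, -4, -2, -4), (-2, -2, 2, 2), (4, 2, 0, 4), (-4, 0, -4, -2), (0, 0, 0, 0), (2, 4, 4, 0)],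
   [(4, 4, 0, 2), (-4, 0, -2, -4), (2, -2, 2, -2), (0, 2, 4, 4), (-2, -4, -4, 0), (0, 0, 0, 0)]] ! j ! k)"

text \<open>
  The five perfect matchings of a 1-factorization of \<open>K\<^sub>6\<close>, as fixed-point-free involutions of
  the six points. Its stabiliser in \<open>S\<^sub>6\<close> is \<open>PGL(2, 5)\<close>.
\<close>

definition factorization :: "nat list list" where
  "factorization = [[1,0,4,5,2,3], [2,3,0,1,5,4], [3,4,5,0,1,2], [4,5,3,2,0,1], [5,2,1,4,3,0]]"

text \<open>
  \<open>point\<close> is constant on cosets of \<open>H\<close>; the next lemma says that it separates them.
\<close>

lemma point_act_alpha_beta:
  "\<forall>xs \<in> words. point (act word_alpha xs) = point xs \<and> point (act word_beta xs) = point xs"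
  by code_simp

lemma affine_orbit:
  "\<forall>xs \<in> words. \<exists>i \<in> set [0..<5]. \<exists>k \<in> set [0..<4]. affine i k xs = reps ! point xs"
  by code_simp

lemma reps_words: "set reps \<subseteq> words"
  by code_simp

lemma point_reps: "\<forall>j \<in> set [0..<6]. point (reps ! j) = j"
  by code_simp

text \<open>
  The arcs of the graph lead from \<open>H\<sigma>x\<close> to \<open>H\<gamma>\<^sup>u\<sigma>x\<close>, and \<open>\<gamma>\<^sup>u = \<gamma>u\<^sup>2\<close>. So the table is correct if
  the image of \<open>u\<^sup>2\<close> under \<open>\<sigma>\<close> depends only on the cosets of \<open>\<sigma>\<close> and \<open>\<gamma>\<sigma>\<close>, as it does.
\<close>

lemma voltage_step:
  "\<forall>xs \<in> words. point xs < 6 \<and> point (act word_gamma xs) < 6 \<and> point xs \<noteq> point (act word_gamma xs) \<and>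
    voltage (point xs) (point (act word_gamma xs)) = lam_word xs (2, -2, -2, 2)"
  by code_simp

lemma step_exists: "\<forall>j \<in> set [0..<6]. \<forall>k \<in> set [0..<6]. j \<noteq> k \<longrightarrow>
   (\<exists>i \<in> set [0..<5]. point (act word_gamma (affine i 0 (reps ! j))) = k)"
  by code_simp

text \<open>
  The elements of \<open>H\<close> that fix the point 1 are transitive on the points 2 to 5.
\<close>

lemma two_arc_words: "\<forall>l \<in> set [2..<6]. \<exists>i \<in> set [0..<5]. \<exists>k \<in> set [0..<4].
   point (act (reps ! 1) (affine i k [1,2,3,4,5])) = 1 \<and>
   point (act (reps ! 2) (affine i k [1,2,3,4,5])) = l"
  by code_simp

section \<open>Pentagons\<close>

text \<open>
  The 5-cycle through the 2-arc \<open>x, v, y\<close> continues to the point \<open>z\<close> for which \<open>vy\<close> and \<open>xz\<close>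
  belong to the same matching of \<open>factorization\<close>.
\<close>

definition pent_next :: "nat \<Rightarrow> nat \<Rightarrow> nat \<Rightarrow> nat" where
  "pent_next v y x = hd (filter (\<lambda>s. s ! v = y) factorization) ! x"

text \<open>
  Even numbers of absolute value less than 14 are not divisible by a prime \<open>p \<ge> 7\<close>, unless
  they are 0. This makes the inspection of closed walks independent of \<open>p\<close>.
\<close>

definition small_even :: "int \<Rightarrow> bool" where
  "small_even c \<longleftrightarrow> c \<noteq> 0 \<and> even c \<and> \<bar>c\<bar> < 14"

definition some_small_even :: "vec4 \<Rightarrow> bool" where
  "some_small_even = (\<lambda>(i, j, k, l). small_even i \<or> small_even j \<or> small_even k \<or> small_even l)"

lemma pentagon_unique:
  "\<forall>v \<in> set [0..<6]. \<forall>y \<in> set [0..<6]. v \<noteq> y \<longrightarrow>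
   (\<forall>x \<in> set [0..<6]. x \<noteq> v \<and> x \<noteq> y \<longrightarrow>
    (\<forall>z \<in> set [0..<6]. z \<noteq> y \<and> z \<noteq> v \<and> z \<noteq> pent_next v y x \<longrightarrow>
     (\<forall>w \<in> set [0..<6]. w \<noteq> z \<and> w \<noteq> x \<longrightarrow>
       some_small_even (voltage x v + voltage v y + voltage y z + voltage z w + voltage w x))))"
  by code_simp

lemma pentagon_exists:
  "\<forall>v \<in> set [0..<6]. \<forall>y \<in> set [0..<6]. v \<noteq> y \<longrightarrow>
   (\<forall>x \<in> set [0..<6]. x \<noteq> v \<and> x \<noteq> y \<longrightarrow>
    (\<exists>w \<in> set [0..<6]. w \<noteq> pent_next v y x \<and> w \<noteq> x \<and>
       voltage x v + voltage v y + voltage y (pent_next v y x) + voltage (pent_next v y x) w + voltage w x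
         = (0, 0, 0, 0)))"
  by code_simp

lemma pent_next_involution:
  "\<forall>v \<in> set [0..<6]. \<forall>y \<in> set [0..<6]. v \<noteq> y \<longrightarrow>
   pent_next v y v = y \<and> pent_next v y y = v \<and>
   (\<forall>x \<in> set [0..<6]. pent_next v y x < 6 \<and> pent_next v y (pent_next v y x) = x)"
  by code_simp

lemma voltage_minus: "\<forall>v \<in> set [0..<6]. \<forall>y \<in> set [0..<6]. voltage v y + voltage y v = (0, 0, 0, 0)"
  by code_simp

text \<open>
  An automorphism maps the neighbours of a vertex over \<open>v\<close> to those of its image and thereby
  permutes the points; \<open>\<pi>\<close> is the list of values of this permutation, in which the vertex itself
  accounts for \<open>v\<close>. Then \<open>transport \<pi> v y\<close> is the permutation at the neighbour over \<open>y\<close>, if the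
  automorphism preserves 5-cycles, and \<open>carry\<close> continues this along a walk.
\<close>

definition transport :: "nat list \<Rightarrow> nat \<Rightarrow> nat \<Rightarrow> nat list" where
  "transport \<pi> v y = map (\<lambda>k. pent_next (\<pi> ! v) (\<pi> ! y) (\<pi> ! pent_next v y k)) [0..<6]"

fun carry :: "nat list \<Rightarrow> nat list \<Rightarrow> nat list" where
  "carry \<pi> (v # y # C) = carry (transport \<pi> v y) (y # C)"
| "carry \<pi> C = \<pi>"

text \<open>
  The five lists are the non-trivial permutations that fix the points 0, 1 and 2. For each of
  them there is a 5-cycle around which it does not return to itself.
\<close>

lemma holonomy:
  "carry [0,1,2,3,5,4] [0,2,3,4,1,0] \<noteq> [0,1,2,3,5,4]"
  "carry [0,1,2,4,3,5] [0,2,3,4,1,0] \<noteq> [0,1,2,4,3,5]"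
  "carry [0,1,2,4,5,3] [0,3,4,5,1,0] \<noteq> [0,1,2,4,5,3]"
  "carry [0,1,2,5,3,4] [0,4,5,2,1,0] \<noteq> [0,1,2,5,3,4]"
  "carry [0,1,2,5,4,3] [0,2,3,4,1,0] \<noteq> [0,1,2,5,4,3]"
  by code_simp+

lemma pentagon_voltages:
  "voltage 0 2 + voltage 2 3 + voltage 3 4 + voltage 4 1 + voltage 1 0 = (0, 0, 0, 0)"
  "voltage 0 3 + voltage 3 4 + voltage 4 5 + voltage 5 1 + voltage 1 0 = (0, 0, 0, 0)"
  "voltage 0 4 + voltage 4 5 + voltage 5 2 + voltage 2 1 + voltage 1 0 = (0, 0, 0, 0)"
  by code_simp+

section \<open>The group L\<close>

text \<open>The generators \<open>a, b, c, d, e\<close> are numbered from 1 to 5.\<close>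

definition bvec :: "nat \<Rightarrow> vec4" where
  "bvec t = (if t = 1 then (1, 0, 0, 0) else if t = 2 then (0, 1, 0, 0) else if t = 3 then (0, 0, 1, 0)
             else if t = 4 then (0, 0, 0, 1) else (-1, -1, -1, -1))"

definition gen :: "nat \<Rightarrow> nat \<Rightarrow> vec4" where
  "gen p t = red p (bvec t)"

lemma red_eq_dvd:
  "red p x = red p y \<longleftrightarrow> (\<forall>t \<in> {1..4}. int p dvd coord x t - coord y t)"
proof -
  have "{1..4::nat} = {1, 2, 3, 4}" by auto
  then show ?thesis
    by (cases x; cases y) (simp add: red_def coord_def mod_eq_dvd_iff)
qed

lemma red_eq_small:
  assumes "red p x = red p y" and small: "\<And>t. t \<in> {1..4} \<Longrightarrow> \<bar>coord x t - coord y t\<bar> < int p"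
  shows "x = y"
proof (rule coord_eqI)
  fix t :: nat assume t: "t \<in> {1..4}"
  then have "int p dvd coord x t - coord y t" using assms(1) red_eq_dvd by blast
  then show "coord x t = coord y t"
    using small[OF t] zdvd_imp_le[of "int p" "\<bar>coord x t - coord y t\<bar>"] by fastforce
qed

lemma coord_bvec:
  assumes "s \<in> {1..5}" "t \<in> {1..5}"
  shows "coord (bvec s) t = of_bool (s = t) - of_bool (s = 5)"
  using assms unfolding in_five by (elim disjE) (simp_all add: bvec_def coord_def)

lemma coord_scale: "coord (scale n x) t = n * coord x t"
  by (cases x) (simp add: coord_def scale_def)

lemma lam_bvec:
  assumes "\<sigma> permutes {1..5}" "t \<in> {1..5}"
  shows "lam \<sigma> (bvec (\<sigma> t)) = scale (sign \<sigma>) (bvec t)"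
proof (rule coord_eqI)
  fix r :: nat assume "r \<in> {1..4}"
  then have r: "r \<in> {1..5}" "r \<noteq> 5" by auto
  have m: "\<sigma> s \<in> {1..5}" if "s \<in> {1..5}" for s
    using that permutes_in_image[OF assms(1)] by blast
  have eq: "\<sigma> s = \<sigma> s' \<longleftrightarrow> s = s'" for s s'
    using permutes_inj[OF assms(1)] by (simp add: inj_eq)
  have "coord (lam \<sigma> (bvec (\<sigma> t))) r = sign \<sigma> * (of_bool (t = r) - of_bool (t = 5))"
    using coord_bvec[OF m[OF assms(2)] m[OF r(1)]] coord_bvec[OF m[OF assms(2)] m, of 5]
    by (simp add: coord_lam[OF r(1)] eq)
  also have "\<dots> = coord (scale (sign \<sigma>) (bvec t)) r"
    using r assms(2) by (simp add: coord_scale coord_bvec)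
  finally show "coord (lam \<sigma> (bvec (\<sigma> t))) r = coord (scale (sign \<sigma>) (bvec t)) r" .
qed

lemma coord_bvec_bounds: "\<bar>coord (bvec s) t\<bar> \<le> 1"
  by (simp add: bvec_def coord_def)

lemma bvec_inj:
  assumes "s \<in> {1..5}" "t \<in> {1..5}" "bvec s = bvec t"
  shows "s = t"
  using assms unfolding in_five by (elim disjE) (simp_all add: bvec_def)

lemma bvec_neq_minus:
  assumes "s \<in> {1..5}"
  shows "scale (-1) (bvec 1) \<noteq> bvec s"
  using assms unfolding in_five by (elim disjE) (simp_all add: bvec_def scale_def)

lemma scale_1 [simp]: "scale 1 x = x"
  by (cases x) (simp add: scale_def)

type_synonym vertex = "(vec4 \<times> (vec4 \<Rightarrow> vec4)) set"

locale big_prime =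
  fixes p :: nat
  assumes prime: "prime p" and ge7: "p \<ge> 7"
begin

abbreviation "M \<equiv> grpM p"

lemma p_pos [simp]: "p > 0" using ge7 by simp

lemma gen_inj: "inj_on (gen p) {1..5}"
proof (rule inj_onI)
  fix s t :: nat assume st: "s \<in> {1..5}" "t \<in> {1..5}" "gen p s = gen p t"
  have "bvec s = bvec t"
  proof (rule red_eq_small)
    show "red p (bvec s) = red p (bvec t)" using st(3) by (simp add: gen_def)
    show "\<bar>coord (bvec s) r - coord (bvec t) r\<bar> < int p" for r
      using coord_bvec_bounds[of s r] coord_bvec_bounds[of t r] ge7 by linarith
  qed
  then show "s = t" using st bvec_inj by blast
qed

lemma gen_in_M [simp]: "gen p t \<in> carrier M"
  by (simp add: gen_def)

lemma gens:
  "genA = gen p 1" "genB = gen p 2" "genC = gen p 3" "genD = gen p 4" "genE p = gen p 5"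
proof -
  show g: "genA = gen p 1" "genB = gen p 2" "genC = gen p 3" "genD = gen p 4"
    using ge7 by (simp_all add: gen_def bvec_def red_def genA_def genB_def genC_def genD_def)
  show "genE p = gen p 5"
    unfolding genE_def g by (simp add: gen_def bvec_def)
qed

lemma Delta_eq: "Delta p = gen p ` {1..5}"
  unfolding five_eq by (auto simp: Delta_def gens)

lemma Lam_gen:
  assumes "\<sigma> permutes {1..5}" "t \<in> {1..5}"
  shows "Lam p \<sigma> (gen p (\<sigma> t)) = red p (scale (sign \<sigma>) (bvec t))"
  using lam_bvec[OF assms] by (simp add: Lam_apply gen_def)

lemma Lam_gen_even:
  assumes "\<sigma> permutes {1..5}" "evenperm \<sigma>" "t \<in> {1..5}"
  shows "Lam p \<sigma> (gen p (\<sigma> t)) = gen p t"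
  using Lam_gen[OF assms(1,3)] assms(2) by (simp add: sign_def gen_def)

text \<open>
  An odd permutation sends generators to inverses of generators, and these are not
  generators as \<open>p > 2\<close>.
\<close>

lemma Lam_eq_id:
  assumes \<sigma>: "\<sigma> permutes {1..5}" and id: "\<And>t. t \<in> {1..5} \<Longrightarrow> Lam p \<sigma> (gen p t) = gen p t"
  shows "\<sigma> = id"
proof -
  have *: "scale (sign \<sigma>) (bvec t) = bvec (\<sigma> t)" if t: "t \<in> {1..5}" for t
  proof (rule red_eq_small)
    have "\<sigma> t \<in> {1..5}" using t permutes_in_image[OF \<sigma>] by blast
    then show "red p (scale (sign \<sigma>) (bvec t)) = red p (bvec (\<sigma> t))"
      using Lam_gen[OF \<sigma> t] id[of "\<sigma> t"] by (simp add: gen_def)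
    have *: "\<bar>coord (scale (sign \<sigma>) (bvec t)) r\<bar> \<le> 1" for r
      using coord_bvec_bounds[of t r] by (simp add: coord_scale abs_mult)
    show "\<bar>coord (scale (sign \<sigma>) (bvec t)) r - coord (bvec (\<sigma> t)) r\<bar> < int p" for r
      using *[of r] coord_bvec_bounds[of "\<sigma> t" r] ge7 by linarith
  qed
  have img: "\<sigma> t \<in> {1..5}" if "t \<in> {1..5}" for t
    using that permutes_in_image[OF \<sigma>] by blast
  have "sign \<sigma> = 1"
  proof (cases \<sigma> rule: sign_cases)
    case odd
    then show ?thesis using *[of 1] bvec_neq_minus[OF img[of 1]] by simp
  qed
  then have "\<sigma> t = t" if "t \<in> {1..5}" for t
    using *[OF that] bvec_inj[OF that img[OF that]] by simp
  then show ?thesis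
    using permutes_not_in[OF \<sigma>] by (intro ext) (metis id_apply)
qed

abbreviation "RA \<equiv> right_AutoGroup M"

lemma group_RA: "group RA"
  unfolding right_AutoGroup_def by (rule opposite_group[OF group.AutoGroup[OF group_M]])

lemma carrier_RA: "carrier RA = auto M"
  by (simp add: right_AutoGroup_def AutoGroup_def)

lemma mult_RA: "f \<in> auto M \<Longrightarrow> g \<in> auto M \<Longrightarrow> f \<otimes>\<^bsub>RA\<^esub> g = compose (carrier M) g f"
  by (simp add: right_AutoGroup_def AutoGroup_def BijGroup_def auto_def)

lemma one_RA: "\<one>\<^bsub>RA\<^esub> = (\<lambda>x \<in> carrier M. x)"
  by (simp add: right_AutoGroup_def AutoGroup_def BijGroup_def)

lemma Lam_mult:
  "\<sigma> permutes {1..5} \<Longrightarrow> \<tau> permutes {1..5} \<Longrightarrow> Lam p \<sigma> \<otimes>\<^bsub>RA\<^esub> Lam p \<tau> = Lam p (\<sigma> \<circ> \<tau>)"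
  by (simp add: mult_RA Lam_auto Lam_comp)

lemma Lam_hom: "group_hom (sym_group 5) RA (Lam p)"
  by (intro group_hom.intro group_hom_axioms.intro sym_group_is_group group_RA)
     (auto simp: hom_def sym_group_carrier sym_group_mult Lam_mult carrier_RA Lam_auto)

lemma auto_eqI:
  assumes "f \<in> auto M" "g \<in> auto M" and gen: "\<And>t. t \<in> {1..5} \<Longrightarrow> f (gen p t) = g (gen p t)"
  shows "f = g"
proof (rule extensionalityI[of _ "carrier M"])
  show "f \<in> extensional (carrier M)" "g \<in> extensional (carrier M)"
    using assms(1,2) by (auto simp: auto_def Bij_def)
  fix x assume x: "x \<in> carrier M"
  obtain i j k l where ijkl: "x = (i, j, k, l)" by (cases x)
  have word: "x = gen p 1 [^]\<^bsub>M\<^esub> i \<otimes>\<^bsub>M\<^esub> (gen p 2 [^]\<^bsub>M\<^esub> j \<otimes>\<^bsub>M\<^esub> (gen p 3 [^]\<^bsub>M\<^esub> k \<otimes>\<^bsub>M\<^esub> gen p 4 [^]\<^bsub>M\<^esub> l))"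
    using red_carrier[OF p_pos x]
    by (simp add: int_pow_M gen_def red_scale) (simp add: ijkl scale_def bvec_def)
  have pow: "gen p t [^]\<^bsub>M\<^esub> (n::int) \<in> carrier M" for t n
    by (simp add: int_pow_M)
  have app: "h x
      = h (gen p 1) [^]\<^bsub>M\<^esub> i \<otimes>\<^bsub>M\<^esub> (h (gen p 2) [^]\<^bsub>M\<^esub> j \<otimes>\<^bsub>M\<^esub> (h (gen p 3) [^]\<^bsub>M\<^esub> k \<otimes>\<^bsub>M\<^esub> h (gen p 4) [^]\<^bsub>M\<^esub> l))"
    if "h \<in> auto M" for h
  proof -
    interpret h: group_hom M M h
      using that by (intro group_hom.intro group_hom_axioms.intro group_M) (auto simp: auto_def)
    show ?thesis
      by (subst word) (simp add: h.hom_mult h.hom_int_pow pow del: mult_M)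
  qed
  show "f x = g x" by (simp add: app[OF assms(1)] app[OF assms(2)] gen)
qed

lemma Delta_action:
  assumes "\<sigma> permutes {1..5}" "evenperm \<sigma>"
  shows "(\<lambda>x. if x \<in> Delta p then Lam p \<sigma> x else x) = map_permutation {1..5} (gen p) (inv' \<sigma>)"
proof
  fix x
  show "(if x \<in> Delta p then Lam p \<sigma> x else x) = map_permutation {1..5} (gen p) (inv' \<sigma>) x"
  proof (cases "x \<in> Delta p")
    case True
    then obtain s where s: "x = gen p s" "s \<in> {1..5}" by (auto simp: Delta_eq)
    have t: "inv' \<sigma> s \<in> {1..5}" "\<sigma> (inv' \<sigma> s) = s"
      using s(2) permutes_in_image[OF permutes_inv[OF assms(1)]] permutes_inverses(1)[OF assms(1)] by auto
    then show ?thesis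
      using True Lam_gen_even[OF assms t(1)] map_permutation_apply[OF gen_inj s(2)] s(1) by simp
  next
    case False
    then show ?thesis by (simp add: map_permutation_def Delta_eq)
  qed
qed

text \<open>
  An automorphism is determined by its values on \<open>\<Delta>\<close>. Numbering \<open>\<Delta>\<close> by \<open>{1..5}\<close> turns its
  restriction to \<open>\<Delta>\<close> into a permutation of \<open>{1..5}\<close> of the same parity.
\<close>

lemma A_Delta_eq: "A_Delta p = Lam p ` {\<sigma>. \<sigma> permutes {1..5} \<and> evenperm \<sigma>}"
proof (intro equalityI subsetI)
  fix f assume "f \<in> Lam p ` {\<sigma>. \<sigma> permutes {1..5} \<and> evenperm \<sigma>}"
  then obtain \<sigma> where \<sigma>: "\<sigma> permutes {1..5}" "evenperm \<sigma>" and f: "f = Lam p \<sigma>" by auto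
  have inv: "inv' \<sigma> permutes {1..5}" using permutes_inv[OF \<sigma>(1)] .
  have "evenperm (\<lambda>x. if x \<in> Delta p then f x else x)"
    unfolding f Delta_action[OF \<sigma>]
    using evenperm_map_permutation[OF gen_inj inv] evenperm_inv[OF permutes_imp_permutation[OF _ \<sigma>(1)]] \<sigma>(2)
    by simp
  moreover have "f ` Delta p = Delta p"
  proof -
    have "Delta p = gen p ` \<sigma> ` {1..5}" by (simp add: Delta_eq permutes_image[OF \<sigma>(1)])
    then have "f ` Delta p = (\<lambda>t. f (gen p (\<sigma> t))) ` {1..5}" by (simp add: image_image)
    also have "\<dots> = gen p ` {1..5}"
      by (rule image_cong) (simp_all add: f Lam_gen_even[OF \<sigma>] del: atLeastAtMost_iff)
    finally show ?thesis by (simp add: Delta_eq)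
  qed
  ultimately show "f \<in> A_Delta p"
    using \<sigma> unfolding f by (simp add: A_Delta_def Aut_M_Delta_def Lam_auto)
next
  fix f assume "f \<in> A_Delta p"
  define F where "F = (\<lambda>x. if x \<in> Delta p then f x else x)"
  have f: "f \<in> auto M" "f ` Delta p = Delta p" "evenperm F"
    using \<open>f \<in> A_Delta p\<close> by (auto simp: A_Delta_def Aut_M_Delta_def F_def)
  define h where "h = inv_into {1..5} (gen p)"
  have h: "bij_betw h (Delta p) {1..5}"
    unfolding h_def Delta_eq by (intro bij_betw_inv_into inj_on_imp_bij_betw gen_inj)
  have "inj_on f (Delta p)"
  proof (rule inj_on_subset)
    show "inj_on f (carrier M)" using f(1) by (simp add: auto_def Bij_def bij_betw_def)
  qed (auto simp: Delta_eq)
  then have F: "F permutes Delta p"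
    using f(2) by (intro bij_imp_permutes) (auto simp: F_def bij_betw_def inj_on_def)
  define \<tau> where "\<tau> = map_permutation (Delta p) h F"
  have \<tau>: "\<tau> permutes {1..5}" unfolding \<tau>_def by (rule map_permutation_permutes[OF h F])
  have even: "evenperm \<tau>"
    using evenperm_map_permutation[OF bij_betw_imp_inj_on[OF h] F] f(3) by (simp add: \<tau>_def Delta_eq)
  have gen: "gen p (\<tau> t) = f (gen p t)" if t: "t \<in> {1..5}" for t
  proof -
    have "gen p t \<in> Delta p" using t by (simp add: Delta_eq)
    moreover have "h (gen p t) = t" unfolding h_def by (rule inv_into_f_f[OF gen_inj t])
    ultimately have "\<tau> t = h (f (gen p t))"
      using map_permutation_apply[OF bij_betw_imp_inj_on[OF h], of "gen p t" F] by (simp add: \<tau>_def F_def)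
    moreover have "f (gen p t) \<in> gen p ` {1..5}"
      using f(2) t by (auto simp: Delta_eq)
    ultimately show ?thesis by (simp add: h_def f_inv_into_f)
  qed
  define \<sigma> where "\<sigma> = inv' \<tau>"
  have \<sigma>: "\<sigma> permutes {1..5}" "evenperm \<sigma>"
    using permutes_inv[OF \<tau>] evenperm_inv[OF permutes_imp_permutation[OF _ \<tau>]] even by (simp_all add: \<sigma>_def)
  have "f = Lam p \<sigma>"
  proof (rule auto_eqI[OF f(1) Lam_auto[OF p_pos \<sigma>(1)]])
    fix t :: nat assume t: "t \<in> {1..5}"
    have "\<tau> t \<in> {1..5}" "\<sigma> (\<tau> t) = t"
      using t permutes_in_image[OF \<tau>] permutes_inverses(2)[OF \<tau>] by (auto simp: \<sigma>_def)
    then show "f (gen p t) = Lam p \<sigma> (gen p t)"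
      using Lam_gen_even[OF \<sigma>, of "\<tau> t"] gen[OF t] by simp
  qed
  with \<sigma> show "f \<in> Lam p ` {\<sigma>. \<sigma> permutes {1..5} \<and> evenperm \<sigma>}" by blast
qed

lemma endo_M_eq:
  "endo_M p (red p a) (red p b) (red p c) (red p d)
     = restrict (\<lambda>(i, j, k, l). red p (scale i a + scale j b + scale k c + scale l d)) (carrier M)"
proof -
  have "red p (scale i (red p a) + scale j (red p b) + scale k (red p c) + scale l (red p d))
      = red p (scale i a + scale j b + scale k c + scale l d)" for i j k l
    by (intro red_add_cong) (simp_all add: red_scale)
  then show ?thesis
    by (intro ext) (simp add: endo_M_def int_pow_M restrict_def split: prod.split)
qed

lemma inv_gen: "inv\<^bsub>M\<^esub> gen p t = red p (- bvec t)"
  by (simp add: gen_def)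

lemma beta_word: "word_beta \<in> words" and alpha_word: "word_alpha \<in> words" and gamma_word: "word_gamma \<in> words"
  by code_simp+

abbreviation "\<alpha> \<equiv> perm_of word_alpha"
abbreviation "\<beta> \<equiv> perm_of word_beta"
abbreviation "\<gamma> \<equiv> perm_of word_gamma"

lemma abg_permutes: "\<alpha> permutes {1..5}" "\<beta> permutes {1..5}" "\<gamma> permutes {1..5}"
  by (simp_all add: perm_of_permutes alpha_word beta_word gamma_word)

lemma lam_perm_of: "xs \<in> words \<Longrightarrow> lam (perm_of xs) x = lam_word xs x"
  by (simp add: lam_eq_lam_word perm_of_permutes words_length)

lemma lam_\<alpha>: "lam \<alpha> (i, j, k, l) = (- l, i - l, j - l, k - l)"
  by (simp only: lam_perm_of[OF alpha_word]) (simp add: lam_word_def word_alpha_def coord_def)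

lemma lam_\<beta>: "lam \<beta> (i, j, k, l) = (- k, - i, - l, - j)"
  by (simp only: lam_perm_of[OF beta_word]) (simp add: lam_word_def word_beta_def coord_def)

lemma lam_\<gamma>: "lam \<gamma> (i, j, k, l) = (j, i, l, k)"
  by (simp only: lam_perm_of[OF gamma_word]) (simp add: lam_word_def word_gamma_def coord_def)

lemma aut_alpha_eq: "aut_alpha p = Lam p \<alpha>"
proof -
  have "aut_alpha p = endo_M p (red p (bvec 2)) (red p (bvec 3)) (red p (bvec 4)) (red p (bvec 5))"
    by (simp add: aut_alpha_def gens gen_def)
  also have "\<dots> = Lam p \<alpha>"
    by (rule ext) (auto simp: endo_M_eq Lam_def restrict_def lam_\<alpha> scale_def bvec_def)
  finally show ?thesis .
qed

lemma aut_gamma_eq: "aut_gamma p = Lam p \<gamma>"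
proof -
  have "aut_gamma p = endo_M p (red p (bvec 2)) (red p (bvec 1)) (red p (bvec 4)) (red p (bvec 3))"
    by (simp add: aut_gamma_def gens gen_def)
  also have "\<dots> = Lam p \<gamma>"
    by (rule ext) (auto simp: endo_M_eq Lam_def restrict_def lam_\<gamma> scale_def bvec_def)
  finally show ?thesis .
qed

lemma aut_beta_eq: "aut_beta p = Lam p \<beta>"
proof -
  have "aut_beta p = endo_M p (red p (- bvec 2)) (red p (- bvec 4)) (red p (- bvec 1)) (red p (- bvec 3))"
    by (simp add: aut_beta_def gens inv_gen)
  also have "\<dots> = Lam p \<beta>"
    by (rule ext) (auto simp: endo_M_eq Lam_def restrict_def lam_\<beta> scale_def bvec_def)
  finally show ?thesis .
qed

lemma sign_beta: "sign \<beta> = - 1"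
  by (simp add: sign_eq_inversion_sign abg_permutes words_length beta_word) (simp add: word_beta_def)

text \<open>
  Every odd permutation is the product of that of \<open>\<beta>\<close> and an even one, and the twist by the
  sign makes \<open>Lam p\<close> multiplicative and agrees with the minus signs in \<open>\<beta>\<close>.
\<close>

lemma carrier_L: "carrier (grpL p) = Lam p ` {\<sigma>. \<sigma> permutes {1..5}}"
proof -
  interpret RA: group RA by (rule group_RA)
  interpret Lam: group_hom "sym_group 5" RA "Lam p" by (rule Lam_hom)
  let ?P = "{\<sigma>. \<sigma> permutes {1..5::nat}}"
  have sub: "A_Delta p \<union> {aut_beta p} \<subseteq> Lam p ` ?P"
    using abg_permutes by (auto simp: A_Delta_eq aut_beta_eq)
  have img: "Lam p ` ?P \<subseteq> carrier RA"
    by (auto simp: carrier_RA Lam_auto)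
  have carrier: "carrier (grpL p) = generate RA (A_Delta p \<union> {aut_beta p})"
    by (simp only: grpL_def carrier_subgroup_generated Int_absorb1[OF subset_trans[OF sub img]])
  have "subgroup (Lam p ` carrier (sym_group 5)) RA"
    by (rule Lam.img_is_subgroup)
  then have "generate RA (A_Delta p \<union> {aut_beta p}) \<subseteq> Lam p ` ?P"
    using RA.generate_subgroup_incl[OF sub] by (simp add: sym_group_def)
  moreover have "Lam p \<sigma> \<in> generate RA (A_Delta p \<union> {aut_beta p})" if \<sigma>: "\<sigma> permutes {1..5}" for \<sigma>
  proof (cases "evenperm \<sigma>")
    case True
    then show ?thesis using \<sigma> by (intro generate.incl) (auto simp: A_Delta_eq)
  next
    case False
    let ?\<tau> = "inv' \<beta> \<circ> \<sigma>"
    have b: "inv' \<beta> permutes {1..5}" using permutes_inv[OF abg_permutes(2)] .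
    have \<tau>: "?\<tau> permutes {1..5}" using permutes_compose[OF \<sigma> b] .
    have "\<not> evenperm \<beta>" using sign_beta by (auto simp: sign_def split: if_splits)
    then have "evenperm ?\<tau>"
      using False evenperm_comp[OF permutes_imp_permutation[OF _ b] permutes_imp_permutation[OF _ \<sigma>]]
        evenperm_inv[OF permutes_imp_permutation[OF _ abg_permutes(2)]] by simp
    then have "Lam p ?\<tau> \<in> generate RA (A_Delta p \<union> {aut_beta p})"
      using \<tau> by (intro generate.incl) (auto simp: A_Delta_eq)
    moreover have "Lam p \<beta> \<in> generate RA (A_Delta p \<union> {aut_beta p})"
      by (intro generate.incl) (simp add: aut_beta_eq)
    ultimately have "Lam p \<beta> \<otimes>\<^bsub>RA\<^esub> Lam p ?\<tau> \<in> generate RA (A_Delta p \<union> {aut_beta p})"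
      by (rule generate.eng[rotated])
    moreover have "\<beta> \<circ> ?\<tau> = \<sigma>"
      by (simp add: o_assoc permutes_inv_o[OF abg_permutes(2)])
    ultimately show ?thesis by (simp add: Lam_mult[OF abg_permutes(2) \<tau>])
  qed
  ultimately show ?thesis using carrier by blast
qed

lemma mult_L: "\<sigma> permutes {1..5} \<Longrightarrow> \<tau> permutes {1..5} \<Longrightarrow> Lam p \<sigma> \<otimes>\<^bsub>grpL p\<^esub> Lam p \<tau> = Lam p (\<sigma> \<circ> \<tau>)"
  by (simp add: grpL_def subgroup_generated_def Lam_mult)

lemma one_L: "\<one>\<^bsub>grpL p\<^esub> = Lam p id"
  by (simp add: grpL_def subgroup_generated_def one_RA Lam_id)

lemma group_L: "group (grpL p)"
  unfolding grpL_def by (rule group.group_subgroup_generated[OF group_RA])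

lemma inv_L: "\<sigma> permutes {1..5} \<Longrightarrow> inv\<^bsub>grpL p\<^esub> (Lam p \<sigma>) = Lam p (inv' \<sigma>)"
  by (rule group.inv_equality[OF group_L])
     (auto simp: mult_L permutes_inv permutes_inv_o one_L carrier_L)

lemma Lam_inj:
  assumes \<sigma>: "\<sigma> permutes {1..5}" and \<tau>: "\<tau> permutes {1..5}" and eq: "Lam p \<sigma> = Lam p \<tau>"
  shows "\<sigma> = \<tau>"
proof -
  have it: "inv' \<tau> permutes {1..5}" using permutes_inv[OF \<tau>] .
  have "Lam p (\<sigma> \<circ> inv' \<tau>) = Lam p (\<tau> \<circ> inv' \<tau>)"
    using Lam_mult[OF \<sigma> it] Lam_mult[OF \<tau> it] eq by simp
  then have "Lam p (\<sigma> \<circ> inv' \<tau>) = (\<lambda>x \<in> carrier M. x)"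
    by (simp add: permutes_inv_o[OF \<tau>] Lam_id)
  then have "\<sigma> \<circ> inv' \<tau> = id"
    by (intro Lam_eq_id permutes_compose[OF it \<sigma>]) simp
  then show ?thesis
    by (metis comp_assoc comp_id id_comp permutes_inv_o(2)[OF \<tau>])
qed

lemma Lam_iso: "Lam p \<in> iso (sym_group 5) (grpL p)"
  using Lam_inj
  by (auto simp: iso_def hom_def sym_group_def carrier_L mult_L bij_betw_def inj_on_def)

section \<open>The group G and the cosets of H\<close>

abbreviation "G \<equiv> grpG p"
abbreviation "H \<equiv> grpH p"

lemma group_G: "group G"
  unfolding grpG_def
proof (rule semidirect_product_group[OF group_M group_L])
  show "k \<in> hom M M" if "k \<in> carrier (grpL p)" for k
    using that Lam_auto by (auto simp: carrier_L auto_def)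
  show "(k \<otimes>\<^bsub>grpL p\<^esub> l) x = l (k x)"
    if "k \<in> carrier (grpL p)" "l \<in> carrier (grpL p)" "x \<in> carrier M" for k l x
    using that by (auto simp: carrier_L mult_L Lam_comp compose_def)
  show "\<one>\<^bsub>grpL p\<^esub> x = x" if "x \<in> carrier M" for x
    using that by (simp add: one_L Lam_id)
qed

text \<open>
  The element \<open>\<sigma>x\<close> of \<open>G\<close>, with the translation on the right. The vertex \<open>H\<sigma>x\<close> depends only on
  the coset of \<open>\<sigma>\<close> and on \<open>x\<close>, so this order is more convenient than the pairs \<open>x\<sigma>\<close>.
\<close>

definition elt :: "vec4 \<Rightarrow> (nat \<Rightarrow> nat) \<Rightarrow> vec4 \<times> (vec4 \<Rightarrow> vec4)" where
  "elt x \<sigma> = (red p (lam (inv' \<sigma>) x), Lam p \<sigma>)"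

lemma red_lam_cong: "red p x = red p y \<Longrightarrow> red p (lam \<sigma> x) = red p (lam \<sigma> y)"
  by (metis red_lam)

lemma lam_cancel:
  assumes "\<sigma> permutes {1..5}"
  shows "lam (inv' \<sigma>) (lam \<sigma> x) = x" "lam \<sigma> (lam (inv' \<sigma>) x) = x"
proof -
  have i: "inv' \<sigma> permutes {1..5}" using permutes_inv[OF assms] .
  show "lam (inv' \<sigma>) (lam \<sigma> x) = x" "lam \<sigma> (lam (inv' \<sigma>) x) = x"
    using lam_comp[OF assms i, of x] lam_comp[OF i assms, of x] permutes_inv_o[OF assms] by simp_all
qed

lemma elt_cong: "red p x = red p y \<Longrightarrow> elt x \<sigma> = elt y \<sigma>"
  unfolding elt_def by (metis red_lam)

lemma elt_eq_iff:
  assumes \<sigma>: "\<sigma> permutes {1..5}" and \<tau>: "\<tau> permutes {1..5}"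
  shows "elt x \<sigma> = elt y \<tau> \<longleftrightarrow> red p x = red p y \<and> \<sigma> = \<tau>"
proof
  assume eq: "elt x \<sigma> = elt y \<tau>"
  then have "\<sigma> = \<tau>" using Lam_inj[OF \<sigma> \<tau>] by (simp add: elt_def)
  moreover have "red p (lam \<tau> (lam (inv' \<tau>) x)) = red p (lam \<tau> (lam (inv' \<tau>) y))"
    using eq \<open>\<sigma> = \<tau>\<close> by (intro red_lam_cong[of "lam (inv' \<tau>) x" "lam (inv' \<tau>) y"]) (simp add: elt_def)
  ultimately show "red p x = red p y \<and> \<sigma> = \<tau>" by (simp add: lam_cancel[OF \<tau>])
next
  assume "red p x = red p y \<and> \<sigma> = \<tau>"
  then show "elt x \<sigma> = elt y \<tau>" using elt_cong by blast
qed

lemma elt_mult: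
  assumes \<sigma>: "\<sigma> permutes {1..5}" and \<tau>: "\<tau> permutes {1..5}"
  shows "elt x \<sigma> \<otimes>\<^bsub>G\<^esub> elt y \<tau> = elt (lam \<tau> x + y) (\<sigma> \<circ> \<tau>)"
proof -
  have i: "inv' \<sigma> permutes {1..5}" "inv' \<tau> permutes {1..5}"
    using permutes_inv \<sigma> \<tau> by blast+
  have "inv' (\<sigma> \<circ> \<tau>) = inv' \<tau> \<circ> inv' \<sigma>"
    using \<sigma> \<tau> by (simp add: o_inv_distrib permutes_bij)
  then have "lam (inv' (\<sigma> \<circ> \<tau>)) (lam \<tau> x + y) = lam (inv' \<sigma>) x + lam (inv' \<sigma>) (lam (inv' \<tau>) y)"
    by (simp add: lam_comp[OF i(2,1)] lam_add lam_cancel[OF \<tau>] del: o_apply)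
  then show ?thesis
    by (simp add: elt_def grpG_def semidirect_product_def inv_L[OF \<sigma>] mult_L[OF \<sigma> \<tau>] Lam_apply del: o_apply)
qed

lemma elt_in_G: "\<sigma> permutes {1..5} \<Longrightarrow> elt x \<sigma> \<in> carrier G"
  by (auto simp: elt_def grpG_def semidirect_product_def carrier_L)

lemma G_cases:
  assumes "g \<in> carrier G"
  obtains x \<sigma> where "\<sigma> permutes {1..5}" "g = elt x \<sigma>"
proof -
  obtain y \<sigma> where g: "g = (y, Lam p \<sigma>)" "y \<in> carrier M" "\<sigma> permutes {1..5}"
    using assms by (auto simp: grpG_def semidirect_product_def carrier_L)
  then have "g = elt (lam \<sigma> y) \<sigma>"
    by (simp add: elt_def lam_cancel red_carrier)
  with g that show thesis by blast
qed

lemma one_G: "\<one>\<^bsub>G\<^esub> = elt 0 id"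
  by (simp add: elt_def grpG_def semidirect_product_def one_L)

lemma inL_eq: "inL p (Lam p \<sigma>) = elt 0 \<sigma>"
  by (simp add: inL_def elt_def)

lemma inM_eq: "inM p (red p x) = elt x id"
  by (simp add: inM_def elt_def one_L)

lemma inv_elt_id: "inv\<^bsub>G\<^esub> (elt x id) = elt (- x) id"
  by (rule group.inv_equality[OF group_G])
     (simp_all add: elt_mult permutes_id elt_in_G one_G)

lemma red_diff_left: "red p (red p x - y) = red p (x - y)"
  using red_add_left[of p x "- y"] by simp

lemma red_diff_add: "red p (red p x - y + z) = red p (x - y + z)"
  by (rule red_add_cong) (simp_all add: red_diff_left)

lemma gamma_u_eq: "gamma_u p = elt (2, -2, -2, 2) \<gamma>"
proof -
  have u: "elt_u p = red p (1, -1, -1, 1)"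
    by (simp add: elt_u_def gens inv_gen) (simp add: gen_def red_diff_left red_diff_add, simp add: bvec_def)
  have "lam \<gamma> (- (1, -1, -1, 1)) = (1, -1, -1, 1)"
    by (simp add: lam_\<gamma>)
  then show ?thesis
    by (simp add: gamma_u_def u inM_eq inv_elt_id aut_gamma_eq inL_eq elt_mult abg_permutes permutes_id)
qed

lemma grpH_eq: "H = generate G {elt 0 \<alpha>, elt 0 \<beta>}"
  by (simp add: grpH_def aut_alpha_eq aut_beta_eq inL_eq)

lemma H_subgroup: "subgroup H G"
  unfolding grpH_eq by (rule group.generate_is_subgroup[OF group_G]) (simp add: elt_in_G abg_permutes)

lemma H_mult: "g \<in> H \<Longrightarrow> h \<in> H \<Longrightarrow> g \<otimes>\<^bsub>G\<^esub> h \<in> H"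
  using subgroup.m_closed[OF H_subgroup] .

text \<open>
  The permutations \<open>\<sigma>\<close> whose left multiplications preserve \<open>point\<close> form a group containing \<open>\<alpha>\<close>
  and \<open>\<beta>\<close>, so all elements of \<open>H\<close> are of this kind. This is what keeps the six orbits of \<open>M\<close> on
  the vertices apart.
\<close>

definition preserves_points :: "(nat \<Rightarrow> nat) \<Rightarrow> bool" where
  "preserves_points \<sigma> \<longleftrightarrow> \<sigma> permutes {1..5} \<and>
     (\<forall>\<tau>. \<tau> permutes {1..5} \<longrightarrow> point (vals (\<sigma> \<circ> \<tau>)) = point (vals \<tau>))"

lemma preserves_points_inv:
  assumes "preserves_points \<sigma>"
  shows "preserves_points (inv' \<sigma>)"
  unfolding preserves_points_def
proof (intro conjI allI impI)
  have \<sigma>: "\<sigma> permutes {1..5}" using assms by (simp add: preserves_points_def)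
  show i: "inv' \<sigma> permutes {1..5}" using permutes_inv[OF \<sigma>] .
  fix \<tau> :: "nat \<Rightarrow> nat" assume \<tau>: "\<tau> permutes {1..5}"
  have "\<sigma> \<circ> (inv' \<sigma> \<circ> \<tau>) = \<tau>"
    by (simp add: o_assoc permutes_inv_o[OF \<sigma>])
  then show "point (vals (inv' \<sigma> \<circ> \<tau>)) = point (vals \<tau>)"
    using assms permutes_compose[OF \<tau> i] unfolding preserves_points_def by metis
qed

lemma preserves_points_comp:
  assumes "preserves_points \<sigma>" "preserves_points \<tau>"
  shows "preserves_points (\<sigma> \<circ> \<tau>)"
  using assms permutes_compose unfolding preserves_points_def by (metis comp_assoc)

lemma preserves_points_\<alpha>\<beta>: "preserves_points \<alpha>" "preserves_points \<beta>"
  using point_act_alpha_beta vals_in_words abg_permutes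
  by (auto simp: preserves_points_def vals_comp simp del: o_apply)

lemma inv_elt_0:
  assumes "\<sigma> permutes {1..5}"
  shows "inv\<^bsub>G\<^esub> (elt 0 \<sigma>) = elt 0 (inv' \<sigma>)"
  by (rule group.inv_equality[OF group_G])
     (simp_all add: elt_mult permutes_inv[OF assms] permutes_inv_o[OF assms] assms elt_in_G one_G del: o_apply)

lemma H_elements:
  assumes "g \<in> H"
  obtains \<sigma> where "g = elt 0 \<sigma>" "preserves_points \<sigma>"
proof -
  have "\<exists>\<sigma>. g = elt 0 \<sigma> \<and> preserves_points \<sigma>"
    using assms unfolding grpH_eq
  proof (induction rule: generate.induct)
    case one
    have "preserves_points id" by (simp add: preserves_points_def permutes_id)
    then show ?case using one_G by blast
  next
    case (incl h)
    then show ?case using preserves_points_\<alpha>\<beta> by blast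
  next
    case (inv h)
    then obtain \<sigma> where "h = elt 0 \<sigma>" "preserves_points \<sigma>" using preserves_points_\<alpha>\<beta> by blast
    then show ?case
      using inv_elt_0 preserves_points_inv unfolding preserves_points_def by metis
  next
    case (eng h1 h2)
    then obtain \<sigma> \<tau> where s: "h1 = elt 0 \<sigma>" "preserves_points \<sigma>" "h2 = elt 0 \<tau>" "preserves_points \<tau>"
      by blast
    then have "h1 \<otimes>\<^bsub>G\<^esub> h2 = elt 0 (\<sigma> \<circ> \<tau>)"
      by (simp add: preserves_points_def elt_mult del: o_apply)
    then show ?case using preserves_points_comp s by blast
  qed
  then show thesis using that by blast
qed

definition affine_perm :: "nat \<Rightarrow> nat \<Rightarrow> nat \<Rightarrow> nat" where
  "affine_perm i k = (\<alpha> ^^ i) \<circ> (\<beta> ^^ k)"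

lemma funpow_permutes: "\<sigma> permutes A \<Longrightarrow> (\<sigma> ^^ n) permutes A"
  by (induction n) (auto intro: permutes_compose permutes_id simp del: o_apply id_apply)

lemma affine_perm_permutes: "affine_perm i k permutes {1..5}"
  unfolding affine_perm_def by (intro permutes_compose funpow_permutes abg_permutes)

lemma vals_affine: "vals (affine_perm i k \<circ> \<tau>) = affine i k (vals \<tau>)"
proof -
  have "map (\<sigma> ^^ n) xs = (map \<sigma> ^^ n) xs" for \<sigma> :: "nat \<Rightarrow> nat" and n xs
  proof (induction n)
    case (Suc n)
    have "map (\<sigma> ^^ Suc n) xs = map \<sigma> (map (\<sigma> ^^ n) xs)" by simp
    also have "\<dots> = (map \<sigma> ^^ Suc n) xs" unfolding Suc by simp
    finally show ?case .
  qed simp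
  then show ?thesis
    by (simp add: affine_perm_def affine_def vals_comp flip: map_map del: o_apply)
qed

lemma funpow_in_H: "\<sigma> permutes {1..5} \<Longrightarrow> elt 0 \<sigma> \<in> H \<Longrightarrow> elt 0 (\<sigma> ^^ n) \<in> H"
proof (induction n)
  case 0
  then show ?case using subgroup.one_closed[OF H_subgroup] by (simp add: one_G id_def)
next
  case (Suc n)
  then have "elt 0 (\<sigma> \<circ> \<sigma> ^^ n) \<in> H"
    using H_mult[of "elt 0 \<sigma>" "elt 0 (\<sigma> ^^ n)"] by (simp add: elt_mult funpow_permutes del: o_apply)
  then show ?case by (simp only: funpow.simps(2))
qed

lemma affine_in_H: "elt 0 (affine_perm i k) \<in> H"
proof -
  have "elt 0 \<alpha> \<in> H" "elt 0 \<beta> \<in> H"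
    unfolding grpH_eq by (auto intro: generate.incl)
  then have "elt 0 (\<alpha> ^^ i) \<otimes>\<^bsub>G\<^esub> elt 0 (\<beta> ^^ k) \<in> H"
    using funpow_in_H abg_permutes H_mult by blast
  then show ?thesis
    by (simp add: elt_mult funpow_permutes abg_permutes affine_perm_def del: o_apply)
qed

lemma affine_perm_preserves: "preserves_points (affine_perm i k)"
proof -
  obtain \<tau> where "elt 0 (affine_perm i k) = elt 0 \<tau>" "preserves_points \<tau>"
    using H_elements[OF affine_in_H] by metis
  then show ?thesis
    using elt_eq_iff[OF affine_perm_permutes] unfolding preserves_points_def by metis
qed

definition \<delta> :: "nat \<Rightarrow> nat \<Rightarrow> nat" where
  "\<delta> j = perm_of (reps ! j)"

lemma rep_in_words: "j < 6 \<Longrightarrow> reps ! j \<in> words"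
  using reps_words nth_mem[of j reps] by (auto simp: reps_def[THEN arg_cong[where f = length]])

lemma \<delta>_permutes: "j < 6 \<Longrightarrow> \<delta> j permutes {1..5}"
  unfolding \<delta>_def by (intro perm_of_permutes rep_in_words)

lemma vals_\<delta>: "j < 6 \<Longrightarrow> vals (\<delta> j) = reps ! j"
  unfolding \<delta>_def by (intro vals_perm_of words_length rep_in_words)

lemma point_\<delta>: "j < 6 \<Longrightarrow> point (vals (\<delta> j)) = j"
  using point_reps by (simp add: vals_\<delta>)

lemma point_less: "\<sigma> permutes {1..5} \<Longrightarrow> point (vals \<sigma>) < 6"
  using voltage_step vals_in_words by blast

definition V :: "nat \<Rightarrow> vec4 \<Rightarrow> vertex" where
  "V j x = H #>\<^bsub>G\<^esub> elt x (\<delta> j)"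

lemma V_cong: "red p x = red p y \<Longrightarrow> V j x = V j y"
  unfolding V_def using elt_cong by metis

lemma coset_eq_V:
  assumes \<sigma>: "\<sigma> permutes {1..5}"
  shows "H #>\<^bsub>G\<^esub> elt x \<sigma> = V (point (vals \<sigma>)) x"
proof -
  obtain i k where ik: "affine i k (vals \<sigma>) = reps ! point (vals \<sigma>)"
    using affine_orbit vals_in_words[OF \<sigma>] by blast
  have "vals (affine_perm i k \<circ> \<sigma>) = vals (\<delta> (point (vals \<sigma>)))"
    by (simp only: vals_affine ik vals_\<delta>[OF point_less[OF \<sigma>]])
  then have "affine_perm i k \<circ> \<sigma> = \<delta> (point (vals \<sigma>))"
    by (metis perm_of_vals permutes_compose[OF \<sigma> affine_perm_permutes] \<delta>_permutes[OF point_less[OF \<sigma>]])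
  then have "elt 0 (affine_perm i k) \<otimes>\<^bsub>G\<^esub> elt x \<sigma> = elt x (\<delta> (point (vals \<sigma>)))"
    using elt_mult[OF affine_perm_permutes \<sigma>] by simp
  moreover have "H #>\<^bsub>G\<^esub> (elt 0 (affine_perm i k) \<otimes>\<^bsub>G\<^esub> elt x \<sigma>) = H #>\<^bsub>G\<^esub> elt x \<sigma>"
  proof -
    have h: "elt 0 (affine_perm i k) \<in> carrier G" by (rule elt_in_G[OF affine_perm_permutes])
    show ?thesis
      using group.coset_mult_assoc[OF group_G subgroup.subset[OF H_subgroup] h elt_in_G[OF \<sigma>]]
        group.coset_join2[OF group_G h H_subgroup affine_in_H] by simp
  qed
  ultimately show ?thesis by (simp only: V_def)
qed

lemma V_eq_iff:
  assumes "j < 6" "k < 6"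
  shows "V j x = V k y \<longleftrightarrow> j = k \<and> red p x = red p y"
proof
  assume eq: "V j x = V k y"
  have "elt x (\<delta> j) \<in> V j x"
    unfolding V_def using group.rcos_self[OF group_G _ H_subgroup] elt_in_G \<delta>_permutes assms by blast
  then obtain h where h: "h \<in> H" "elt x (\<delta> j) = h \<otimes>\<^bsub>G\<^esub> elt y (\<delta> k)"
    unfolding eq unfolding V_def by (auto simp: r_coset_def)
  obtain \<sigma> where \<sigma>: "h = elt 0 \<sigma>" "preserves_points \<sigma>" using H_elements[OF h(1)] .
  then have p: "\<sigma> permutes {1..5}" by (simp add: preserves_points_def)
  have "elt x (\<delta> j) = elt y (\<sigma> \<circ> \<delta> k)"
    using h(2) by (simp add: \<sigma>(1) elt_mult p \<delta>_permutes assms del: o_apply)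
  then have "red p x = red p y" "\<delta> j = \<sigma> \<circ> \<delta> k"
    using elt_eq_iff[OF \<delta>_permutes[OF assms(1)] permutes_compose[OF \<delta>_permutes[OF assms(2)] p]] by auto
  moreover have "j = k"
    using \<sigma>(2) point_\<delta> assms \<delta>_permutes \<open>\<delta> j = \<sigma> \<circ> \<delta> k\<close> unfolding preserves_points_def by metis
  ultimately show "j = k \<and> red p x = red p y" by simp
next
  assume "j = k \<and> red p x = red p y"
  then show "V j x = V k y" using V_cong by blast
qed

lemma V_mult:
  assumes "j < 6" "\<sigma> permutes {1..5}"
  shows "V j x #>\<^bsub>G\<^esub> elt y \<sigma> = V (point (vals (\<delta> j \<circ> \<sigma>))) (lam \<sigma> x + y)"
proof -
  have "V j x #>\<^bsub>G\<^esub> elt y \<sigma> = H #>\<^bsub>G\<^esub> (elt x (\<delta> j) \<otimes>\<^bsub>G\<^esub> elt y \<sigma>)"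
    unfolding V_def using group.coset_mult_assoc[OF group_G] subgroup.subset[OF H_subgroup] elt_in_G
      \<delta>_permutes assms by blast
  then show ?thesis
    by (simp add: elt_mult \<delta>_permutes assms coset_eq_V[OF permutes_compose] del: o_apply)
qed

lemma rcosets_eq: "rcosets\<^bsub>G\<^esub> H = {V j x | j x. j < 6}"
proof (intro equalityI subsetI)
  fix U assume "U \<in> rcosets\<^bsub>G\<^esub> H"
  then obtain g where "g \<in> carrier G" "U = H #>\<^bsub>G\<^esub> g" by (auto simp: RCOSETS_def)
  moreover obtain x \<sigma> where "\<sigma> permutes {1..5}" "g = elt x \<sigma>"
    using G_cases[OF \<open>g \<in> carrier G\<close>] .
  ultimately show "U \<in> {V j x | j x. j < 6}"
    using coset_eq_V point_less by blast
next
  fix U assume "U \<in> {V j x | j x. j < 6}"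
  then show "U \<in> rcosets\<^bsub>G\<^esub> H"
    using elt_in_G \<delta>_permutes by (auto simp: V_def RCOSETS_def)
qed

section \<open>The graph as a cover of the complete graph on six points\<close>

declare split_paired_Ex [simp del] split_paired_All [simp del]

lemma \<gamma>_squared: "\<gamma> \<circ> \<gamma> = id"
  by (rule ext) (auto simp: perm_of_def word_gamma_def in_five simp del: atLeastAtMost_iff)

sublocale coset_graph: involution_coset_graph G H "gamma_u p"
proof (intro involution_coset_graph.intro involution_coset_graph_axioms.intro group_G H_subgroup)
  show "gamma_u p \<in> carrier G" by (simp add: gamma_u_eq elt_in_G abg_permutes)
  show "gamma_u p \<otimes>\<^bsub>G\<^esub> gamma_u p = \<one>\<^bsub>G\<^esub>"
    by (simp add: gamma_u_eq elt_mult abg_permutes \<gamma>_squared lam_\<gamma> one_G del: o_apply)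
       (simp add: zero_prod_def)
  show "gamma_u p \<notin> H"
  proof
    assume "gamma_u p \<in> H"
    then obtain \<sigma> where "elt (2, -2, -2, 2) \<gamma> = elt 0 \<sigma>" "preserves_points \<sigma>"
      using H_elements unfolding gamma_u_eq by metis
    then have "red p (2, -2, -2, 2) = red p 0"
      using elt_eq_iff abg_permutes unfolding preserves_points_def by blast
    then have "(2, -2, -2, 2) = (0 :: vec4)"
      by (rule red_eq_small) (simp, use ge7 in \<open>auto simp: coord_def\<close>)
    then show False by (simp add: zero_prod_def)
  qed
qed

lemma X_eq: "graph_6p4 p = coset_graph.X"
  by (simp add: graph_6p4_def)

abbreviation "W \<equiv> rcosets\<^bsub>G\<^esub> H"
abbreviation "E \<equiv> parcs coset_graph.X"

lemma voltage_diag: "j < 6 \<Longrightarrow> voltage j j = 0"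
proof -
  have "\<forall>j \<in> set [0..<6]. voltage j j = (0, 0, 0, 0)" by code_simp
  then show "j < 6 \<Longrightarrow> voltage j j = 0" by (simp add: zero_prod_def)
qed

text \<open>
  The description of the graph as a cover of \<open>K\<^sub>6\<close> with voltages in \<open>M\<close>.
\<close>

lemma arcs_eq: "E = {(V j x, V k (x + voltage j k)) | j k x. j < 6 \<and> k < 6 \<and> j \<noteq> k}"
proof (intro equalityI subsetI)
  fix a assume "a \<in> E"
  then obtain g where "g \<in> carrier G" and a: "a = (H #>\<^bsub>G\<^esub> g, H #>\<^bsub>G\<^esub> (gamma_u p \<otimes>\<^bsub>G\<^esub> g))"
    by (auto simp: coset_graph.parcs_X)
  obtain x \<sigma> where \<sigma>: "\<sigma> permutes {1..5}" and g: "g = elt x \<sigma>" using G_cases[OF \<open>g \<in> carrier G\<close>] .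
  have w: "vals \<sigma> \<in> words" by (rule vals_in_words[OF \<sigma>])
  have "gamma_u p \<otimes>\<^bsub>G\<^esub> g = elt (lam \<sigma> (2, -2, -2, 2) + x) (\<gamma> \<circ> \<sigma>)"
    by (simp add: g gamma_u_eq elt_mult abg_permutes \<sigma> del: o_apply)
  then have "a = (V (point (vals \<sigma>)) x,
      V (point (act word_gamma (vals \<sigma>))) (x + voltage (point (vals \<sigma>)) (point (act word_gamma (vals \<sigma>)))))"
    using voltage_step[rule_format, OF w]
    by (simp add: a g coset_eq_V[OF \<sigma>] coset_eq_V[OF permutes_compose[OF \<sigma> abg_permutes(3)]] vals_comp
        lam_eq_lam_word[OF \<sigma>] add.commute del: o_apply)
  then show "a \<in> {(V j x, V k (x + voltage j k)) | j k x. j < 6 \<and> k < 6 \<and> j \<noteq> k}"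
    using voltage_step[rule_format, OF w] by blast
next
  fix a assume "a \<in> {(V j x, V k (x + voltage j k)) | j k x. j < 6 \<and> k < 6 \<and> j \<noteq> k}"
  then obtain j k x where jk: "j < 6" "k < 6" "j \<noteq> k" and a: "a = (V j x, V k (x + voltage j k))" by blast
  have "j \<in> set [0..<6]" "k \<in> set [0..<6]" using jk by simp_all
  then obtain i where i: "point (act word_gamma (affine i 0 (reps ! j))) = k"
    using step_exists[rule_format, OF _ _ jk(3)] by blast
  define \<sigma> where "\<sigma> = affine_perm i 0 \<circ> \<delta> j"
  have \<sigma>: "\<sigma> permutes {1..5}"
    unfolding \<sigma>_def by (intro permutes_compose \<delta>_permutes affine_perm_permutes jk)
  have w: "vals \<sigma> \<in> words" by (rule vals_in_words[OF \<sigma>])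
  have v: "vals \<sigma> = affine i 0 (reps ! j)" by (simp only: \<sigma>_def vals_affine vals_\<delta>[OF jk(1)])
  have "point (vals \<sigma>) = j"
    using affine_perm_preserves[of i 0] \<delta>_permutes[OF jk(1)] point_\<delta>[OF jk(1)]
    by (simp add: preserves_points_def \<sigma>_def del: o_apply)
  moreover have "gamma_u p \<otimes>\<^bsub>G\<^esub> elt x \<sigma> = elt (lam \<sigma> (2, -2, -2, 2) + x) (\<gamma> \<circ> \<sigma>)"
    by (simp add: gamma_u_eq elt_mult abg_permutes \<sigma> del: o_apply)
  ultimately have "a = (H #>\<^bsub>G\<^esub> elt x \<sigma>, H #>\<^bsub>G\<^esub> (gamma_u p \<otimes>\<^bsub>G\<^esub> elt x \<sigma>))"
    using voltage_step[rule_format, OF w] i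
    by (simp add: a coset_eq_V[OF \<sigma>] coset_eq_V[OF permutes_compose[OF \<sigma> abg_permutes(3)]] vals_comp v
        lam_eq_lam_word[OF \<sigma>] add.commute del: o_apply)
  then show "a \<in> E" using elt_in_G[OF \<sigma>] unfolding coset_graph.parcs_X by blast
qed

definition fibre :: "vertex \<Rightarrow> nat" where
  "fibre U = (THE j. j < 6 \<and> (\<exists>x. U = V j x))"

text \<open>
  The neighbour of \<open>U\<close> over the point \<open>k\<close>; it is \<open>U\<close> itself when \<open>U\<close> lies over \<open>k\<close>, because
  \<open>voltage k k = 0\<close>. The vector chosen for \<open>U\<close> is only determined modulo \<open>p\<close>.
\<close>

definition nbr :: "nat \<Rightarrow> vertex \<Rightarrow> vertex" where
  "nbr k U = V k ((SOME x. U = V (fibre U) x) + voltage (fibre U) k)"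

lemma fibre_V [simp]: "j < 6 \<Longrightarrow> fibre (V j x) = j"
  unfolding fibre_def by (rule the_equality) (blast, metis V_eq_iff)

lemma nbr_V [simp]:
  assumes "j < 6"
  shows "nbr k (V j x) = V k (x + voltage j k)"
proof -
  have "V j x = V j (SOME y. V j x = V j y)" by (rule someI[of _ x]) simp
  then have "red p x = red p (SOME y. V j x = V j y)" using V_eq_iff[OF assms assms] by blast
  then have "V k (x + voltage j k) = V k ((SOME y. V j x = V j y) + voltage j k)"
    by (intro V_cong red_add_cong) simp_all
  then show ?thesis using assms by (simp add: nbr_def)
qed

lemma W_cases:
  assumes "U \<in> W"
  obtains j x where "j < 6" "U = V j x"
  using assms rcosets_eq by blast

lemma V_in_W: "j < 6 \<Longrightarrow> V j x \<in> W"
  using rcosets_eq by blast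

lemma fibre_less: "U \<in> W \<Longrightarrow> fibre U < 6"
  by (auto elim: W_cases)

lemma nbr_in_W: "U \<in> W \<Longrightarrow> k < 6 \<Longrightarrow> nbr k U \<in> W"
  by (auto elim!: W_cases simp: V_in_W)

lemma fibre_nbr: "U \<in> W \<Longrightarrow> k < 6 \<Longrightarrow> fibre (nbr k U) = k"
  by (auto elim!: W_cases)

lemma nbr_fibre: "U \<in> W \<Longrightarrow> nbr (fibre U) U = U"
  by (auto elim!: W_cases simp: voltage_diag)

lemma nbr_back:
  assumes "U \<in> W" "k < 6"
  shows "nbr (fibre U) (nbr k U) = U"
proof -
  obtain j x where j: "j < 6" "U = V j x" using W_cases[OF assms(1)] .
  have "voltage j k + voltage k j = 0" using voltage_minus j(1) assms(2) by (simp add: zero_prod_def)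
  then show ?thesis using j assms(2) by (simp add: add.assoc)
qed

lemma arc_iff:
  assumes "U \<in> W"
  shows "(U, Y) \<in> E \<longleftrightarrow> (\<exists>k<6. k \<noteq> fibre U \<and> Y = nbr k U)"
proof -
  obtain j x where U: "j < 6" "U = V j x" using W_cases[OF assms] .
  show ?thesis
  proof
    assume "(U, Y) \<in> E"
    then obtain j' k x' where "j' < 6" "k < 6" "j' \<noteq> k" "U = V j' x'" "Y = V k (x' + voltage j' k)"
      by (auto simp: arcs_eq)
    then show "\<exists>k<6. k \<noteq> fibre U \<and> Y = nbr k U" by (intro exI[of _ k]) simp
  next
    assume "\<exists>k<6. k \<noteq> fibre U \<and> Y = nbr k U"
    then show "(U, Y) \<in> E" using U by (auto simp: arcs_eq simp del: split_paired_Ex)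
  qed
qed

lemma some_small_even_not_0:
  assumes "some_small_even x" shows "red p x \<noteq> 0"
proof
  assume "red p x = 0"
  obtain i j k l where x: "x = (i, j, k, l)" by (cases x)
  have "\<not> int p dvd c" if "small_even c" for c
  proof
    assume "int p dvd c"
    have c: "c \<noteq> 0" "even c" "\<bar>c\<bar> < 14" using that by (auto simp: small_even_def)
    have "coprime (int p) 2"
      using prime ge7 primes_coprime[of p 2] two_is_prime_nat by (simp flip: coprime_int_iff)
    moreover obtain d where d: "c = 2 * d" using c(2) by (elim evenE)
    ultimately have "int p dvd d"
      using \<open>int p dvd c\<close> by (metis coprime_dvd_mult_right_iff)
    then have "int p \<le> \<bar>d\<bar>"
      using c(1) d by (intro zdvd_imp_le) auto
    then show False using c(3) d ge7 by simp
  qed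
  then show False
    using assms \<open>red p x = 0\<close> by (auto simp: x some_small_even_def red_def zero_prod_def dvd_eq_mod_eq_0)
qed

text \<open>
  Closed walks in the cover are the closed walks in \<open>K\<^sub>6\<close> whose voltages sum to 0.
\<close>

lemma pentagon_at:
  assumes "U \<in> W" "x < 6" "y < 6" "x \<noteq> fibre U" "y \<noteq> fibre U" "x \<noteq> y"
  obtains w where "w < 6" "w \<noteq> pent_next (fibre U) y x" "w \<noteq> x"
    "nbr x (nbr w (nbr (pent_next (fibre U) y x) (nbr y U))) = nbr x U"
proof -
  obtain v u where v: "v < 6" "U = V v u" using W_cases[OF assms(1)] .
  have m: "v \<in> set [0..<6]" "y \<in> set [0..<6]" "x \<in> set [0..<6]" "v \<noteq> y" "x \<noteq> v \<and> x \<noteq> y"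
    using v assms by auto
  have tlt: "pent_next v y x < 6" using pent_next_involution m by blast
  obtain w where w: "w < 6" "w \<noteq> pent_next v y x" "w \<noteq> x"
    "voltage x v + voltage v y + voltage y (pent_next v y x) + voltage (pent_next v y x) w + voltage w x = 0"
    using pentagon_exists[rule_format, OF m(1,2,4,3,5)] by (auto simp: zero_prod_def)
  have cancel: "voltage v x + voltage x v = 0" using voltage_minus v(1) assms(2) by (simp add: zero_prod_def)
  have "voltage v x
      = voltage v x + (voltage x v + voltage v y + voltage y (pent_next v y x)
        + voltage (pent_next v y x) w + voltage w x)"
    by (simp add: w(4))
  also have "\<dots>
      = (voltage v x + voltage x v) + (voltage v y + voltage y (pent_next v y x)
        + voltage (pent_next v y x) w + voltage w x)"
    by (simp only: add.assoc)
  finally have "voltage v y + voltage y (pent_next v y x)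
      + voltage (pent_next v y x) w + voltage w x = voltage v x"
    by (simp add: cancel)
  then have "nbr x (nbr w (nbr (pent_next v y x) (nbr y U))) = nbr x U"
    using v w(1) tlt assms by (simp add: add.assoc)
  with w v that show thesis by simp
qed

text \<open>
  Other continuations of the 2-arc give a voltage sum with a small even non-zero coordinate.
\<close>

lemma pentagon_only:
  assumes "U \<in> W" "x < 6" "y < 6" "z < 6" "w < 6" "x \<noteq> fibre U" "y \<noteq> fibre U" "x \<noteq> y" "z \<noteq> y" "z \<noteq> fibre U"
    "w \<noteq> z" "w \<noteq> x" and eq: "nbr x (nbr w (nbr z (nbr y U))) = nbr x U"
  shows "z = pent_next (fibre U) y x"
proof (rule ccontr)
  assume "z \<noteq> pent_next (fibre U) y x"
  obtain v u where v: "v < 6" "U = V v u" using W_cases[OF assms(1)] .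
  let ?s = "voltage v y + voltage y z + voltage z w + voltage w x"
  have "some_small_even (voltage x v + voltage v y + voltage y z + voltage z w + voltage w x)"
    by (rule pentagon_unique[rule_format]) (use v assms \<open>z \<noteq> pent_next (fibre U) y x\<close> in auto)
  then have nz: "red p (voltage x v + ?s) \<noteq> 0" by (metis some_small_even_not_0 add.assoc)
  have "red p (u + ?s) = red p (u + voltage v x)"
    using eq v assms(2-5) by (simp add: V_eq_iff add.assoc)
  have "red p (voltage x v + ?s) = red p ((voltage x v - u) + (u + ?s))" by simp
  also have "\<dots> = red p ((voltage x v - u) + (u + voltage v x))"
    by (rule red_add_cong) (simp_all only: \<open>red p (u + ?s) = red p (u + voltage v x)\<close>)
  also have "\<dots> = red p (voltage v x + voltage x v)" by (simp add: add.commute)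
  also have "voltage v x + voltage x v = 0" using voltage_minus v(1) assms(2) by (simp add: zero_prod_def)
  finally show False using nz by simp
qed

section \<open>Automorphisms and parallel transport\<close>

text \<open>
  Graph automorphisms without the requirement of extensionality, so that they can be composed
  as functions.
\<close>

definition is_aut :: "(vertex \<Rightarrow> vertex) \<Rightarrow> bool" where
  "is_aut f \<longleftrightarrow> bij_betw f W W \<and> (\<forall>U \<in> W. \<forall>Y \<in> W. (f U, f Y) \<in> E \<longleftrightarrow> (U, Y) \<in> E)"

lemma is_aut_iff: "f \<in> graph_auts coset_graph.X \<longleftrightarrow> f \<in> extensional W \<and> is_aut f"
  by (auto simp: graph_auts_def is_aut_def Bij_def)

lemma is_aut_translate: "g \<in> carrier G \<Longrightarrow> is_aut (coset_graph.translate g)"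
  using coset_graph.translate_aut is_aut_iff by blast

lemma is_aut_comp:
  assumes "is_aut f" "is_aut g"
  shows "is_aut (\<lambda>U. f (g U))"
proof -
  have "bij_betw (f \<circ> g) W W" using assms bij_betw_trans unfolding is_aut_def by blast
  moreover have "g U \<in> W" if "U \<in> W" for U
    using assms(2) that by (auto simp: is_aut_def bij_betw_def)
  ultimately show ?thesis using assms by (auto simp: is_aut_def o_def)
qed

text \<open>
  The permutation of the six points that an automorphism induces at the vertex \<open>U\<close>.
\<close>

definition local_perm :: "(vertex \<Rightarrow> vertex) \<Rightarrow>
    vertex \<Rightarrow> nat \<Rightarrow> nat" where
  "local_perm f U k = fibre (f (nbr k U))"

lemma pent_next_swaps:
  assumes "v < 6" "y < 6" "v \<noteq> y"
  shows "pent_next v y v = y" "pent_next v y y = v"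
  using pent_next_involution assms by simp_all

lemma pent_next_less: "v < 6 \<Longrightarrow> y < 6 \<Longrightarrow> v \<noteq> y \<Longrightarrow> x < 6 \<Longrightarrow> pent_next v y x < 6"
  and pent_next_pent_next: "v < 6 \<Longrightarrow> y < 6 \<Longrightarrow> v \<noteq> y \<Longrightarrow> x < 6 \<Longrightarrow> pent_next v y (pent_next v y x) = x"
  using pent_next_involution by simp_all

fun walk :: "nat list \<Rightarrow> vertex \<Rightarrow> vertex" where
  "walk [] U = U"
| "walk (y # C) U = walk C (nbr y U)"

abbreviation "base \<equiv> V 0 0"

lemma base_in_W: "base \<in> W" by (simp add: V_in_W)

lemma pentagon_walks:
  "walk [2, 3, 4, 1, 0] base = base" "walk [3, 4, 5, 1, 0] base = base" "walk [4, 5, 2, 1, 0] base = base"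
  using pentagon_voltages by (simp_all add: add.assoc zero_prod_def)

context
  fixes f assumes f: "is_aut f"
begin

lemma aut_in_W: "U \<in> W \<Longrightarrow> f U \<in> W"
  using f by (auto simp: is_aut_def bij_betw_def)

lemma aut_inj: "U \<in> W \<Longrightarrow> Y \<in> W \<Longrightarrow> f U = f Y \<Longrightarrow> U = Y"
  using f by (auto simp: is_aut_def bij_betw_def inj_on_def)

lemma local_perm_less: "U \<in> W \<Longrightarrow> k < 6 \<Longrightarrow> local_perm f U k < 6"
  by (simp add: local_perm_def fibre_less aut_in_W nbr_in_W)

lemma local_perm_fibre: "U \<in> W \<Longrightarrow> local_perm f U (fibre U) = fibre (f U)"
  by (simp add: local_perm_def nbr_fibre)

lemma aut_nbr:
  assumes "U \<in> W" "k < 6"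
  shows "f (nbr k U) = nbr (local_perm f U k) (f U)"
proof (cases "k = fibre U")
  case True
  then show ?thesis using assms by (simp add: local_perm_fibre nbr_fibre aut_in_W)
next
  case False
  then have "(U, nbr k U) \<in> E" using assms arc_iff by blast
  then have "(f U, f (nbr k U)) \<in> E" using f assms nbr_in_W by (simp add: is_aut_def)
  then obtain l where "l < 6" "f (nbr k U) = nbr l (f U)" using arc_iff[OF aut_in_W[OF assms(1)]] by blast
  moreover from this have "local_perm f U k = l" using assms by (simp add: local_perm_def fibre_nbr aut_in_W)
  ultimately show ?thesis by simp
qed

lemma local_perm_inj:
  assumes "U \<in> W" "k < 6" "l < 6" "local_perm f U k = local_perm f U l"
  shows "k = l"
proof -
  have "f (nbr k U) = f (nbr l U)" using aut_nbr assms by simp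
  then have "nbr k U = nbr l U" using aut_inj nbr_in_W assms by blast
  then show ?thesis using fibre_nbr assms by metis
qed

lemma local_perm_nbr_fibre: "U \<in> W \<Longrightarrow> y < 6 \<Longrightarrow> local_perm f (nbr y U) (fibre U) = fibre (f U)"
  by (simp add: local_perm_def nbr_back)

lemma local_perm_nbr_self: "U \<in> W \<Longrightarrow> y < 6 \<Longrightarrow> local_perm f (nbr y U) y = local_perm f U y"
  using local_perm_fibre[of "nbr y U"] by (simp add: fibre_nbr nbr_in_W) (simp add: local_perm_def)

text \<open>
  The image of the 5-cycle through a 2-arc is the 5-cycle through the image of the 2-arc. The
  extension of transport by \<open>v \<mapsto> y\<close> and \<open>y \<mapsto> v\<close> corresponds to the fact that the two ends of
  an arc are neighbours of each other.
\<close>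

lemma local_perm_transport:
  assumes U: "U \<in> W" and y: "y < 6" "y \<noteq> fibre U" and x: "x < 6"
  shows "local_perm f (nbr y U) (pent_next (fibre U) y x)
    = pent_next (local_perm f U (fibre U)) (local_perm f U y) (local_perm f U x)"
proof -
  let ?v = "fibre U"
  let ?Y = "nbr y U"
  have v: "?v < 6" by (rule fibre_less[OF U])
  have Y: "?Y \<in> W" by (rule nbr_in_W[OF U y(1)])
  have less: "local_perm f U ?v < 6" "local_perm f U y < 6" "local_perm f U x < 6"
    using U v y x local_perm_less by auto
  have vy: "local_perm f U ?v \<noteq> local_perm f U y" using local_perm_inj[OF U v y(1)] y(2) by auto
  consider "x = ?v" | "x = y" | "x \<noteq> ?v" "x \<noteq> y" by blast
  then show ?thesis
  proof cases
    case 1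
    then show ?thesis using pent_next_swaps[OF v y(1)] pent_next_swaps[OF less(1,2) vy] y
        local_perm_nbr_self U by simp
  next
    case 2
    then show ?thesis using pent_next_swaps[OF v y(1)] pent_next_swaps[OF less(1,2) vy] y
        local_perm_nbr_fibre local_perm_fibre U by simp
  next
    case 3
    define z where "z = pent_next ?v y x"
    have z: "z < 6" using pent_next_less v y x by (auto simp: z_def)
    have zv: "z \<noteq> ?v" "z \<noteq> y"
      using pent_next_pent_next[OF v y(1) y(2)[symmetric] x]
        pent_next_swaps[OF v y(1) y(2)[symmetric]] 3 by (auto simp: z_def)
    obtain w where w: "w < 6" "w \<noteq> z" "w \<noteq> x" "nbr x (nbr w (nbr z ?Y)) = nbr x U"
      using pentagon_at[OF U x y(1) 3(1) y(2) 3(2)] unfolding z_def .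
    have Z: "nbr z ?Y \<in> W" and P: "nbr w (nbr z ?Y) \<in> W" using nbr_in_W Y z w by auto
    \<comment> \<open>Primes denote points of the image cycle.\<close>
    let ?x' = "local_perm f U x" and ?y' = "local_perm f U y"
      and ?z' = "local_perm f ?Y z" and ?w' = "local_perm f (nbr z ?Y) w"
    have fU: "f (nbr x U) = nbr ?x' (f U)" "f ?Y = nbr ?y' (f U)" "f (nbr z ?Y) = nbr ?z' (f ?Y)"
      "f (nbr w (nbr z ?Y)) = nbr ?w' (f (nbr z ?Y))"
      using aut_nbr U Y Z x y z w by auto
    have x': "local_perm f (nbr w (nbr z ?Y)) x = ?x'" using w(4) by (simp add: local_perm_def)
    then have "f (nbr x (nbr w (nbr z ?Y))) = nbr ?x' (f (nbr w (nbr z ?Y)))"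
      using aut_nbr[OF P x] by simp
    then have "nbr ?x' (nbr ?w' (nbr ?z' (nbr ?y' (f U)))) = nbr ?x' (f U)"
      using fU w(4) by simp
    moreover have "?z' < 6" "?w' < 6" using local_perm_less Y Z z w by auto
    moreover have "?x' \<noteq> fibre (f U)" "?y' \<noteq> fibre (f U)" "?x' \<noteq> ?y'"
      using local_perm_inj[OF U] local_perm_fibre[OF U] v x y 3 by metis+
    moreover have "?z' \<noteq> ?y'" using local_perm_inj[OF Y z y(1)] local_perm_nbr_self[OF U y(1)] zv by metis
    moreover have "?z' \<noteq> fibre (f U)" using local_perm_inj[OF Y z v] local_perm_nbr_fibre[OF U y(1)] zv by metis
    moreover have "?w' \<noteq> ?z'" using local_perm_inj[OF Z w(1) z] local_perm_nbr_self[OF Y z] w(2) by metis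
    moreover have "?w' \<noteq> ?x'"
      using local_perm_inj[OF P w(1) x] local_perm_nbr_self[OF Z w(1)] x' w(3) by metis
    ultimately have "?z' = pent_next (fibre (f U)) ?y' ?x'"
      using pentagon_only[OF aut_in_W[OF U], of ?x' ?y' ?z' ?w'] less by blast
    then show ?thesis using local_perm_fibre[OF U] by (simp add: z_def)
  qed
qed

definition local_word :: "vertex \<Rightarrow> nat list" where
  "local_word U = map (local_perm f U) [0..<6]"

lemma local_word_transport:
  assumes U: "U \<in> W" and y: "y < 6" "y \<noteq> fibre U"
  shows "local_word (nbr y U) = transport (local_word U) (fibre U) y"
proof -
  have v: "fibre U < 6" by (rule fibre_less[OF U])
  have "local_perm f (nbr y U) k
      = pent_next (local_perm f U (fibre U)) (local_perm f U y) (local_perm f U (pent_next (fibre U) y k))"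
    if k: "k < 6" for k
    using local_perm_transport[OF U y pent_next_less[OF v y(1) y(2)[symmetric] k]]
      pent_next_pent_next[OF v y(1) y(2)[symmetric] k] by simp
  then show ?thesis
    using pent_next_less[OF v y(1) y(2)[symmetric]] v y
    by (simp add: local_word_def transport_def nth_map del: upt_Suc)
qed

lemma local_word_walk:
  assumes "U \<in> W" "distinct_adj (fibre U # C)" "set C \<subseteq> {..<6}"
  shows "local_word (walk C U) = carry (local_word U) (fibre U # C)"
  using assms
proof (induction C arbitrary: U)
  case (Cons y C)
  then have "local_word (walk C (nbr y U)) = carry (local_word (nbr y U)) (fibre (nbr y U) # C)"
    by (intro Cons.IH) (auto simp: nbr_in_W fibre_nbr)
  with Cons show ?case by (auto simp: fibre_nbr local_word_transport)
qed simp

lemma local_word_closed_walk: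
  assumes "distinct_adj (0 # C)" "set C \<subseteq> {..<6}" "walk C base = base"
  shows "carry (local_word base) (0 # C) = local_word base"
  using local_word_walk[OF base_in_W, of C] assms by simp

text \<open>
  A lifted 5-cycle returns to its starting point, where transport has to give back the same
  local permutation.
\<close>

lemma fixes_neighbours:
  assumes "f base = base" "f (nbr 1 base) = nbr 1 base" "f (nbr 2 base) = nbr 2 base" "k < 6"
  shows "local_perm f base k = k"
proof -
  have l: "local_perm f base 0 = 0" "local_perm f base 1 = 1" "local_perm f base 2 = 2"
    using assms(1-3) local_perm_fibre[OF base_in_W] by (simp_all add: local_perm_def)
  let ?a = "local_perm f base 3" and ?b = "local_perm f base 4" and ?c = "local_perm f base 5"
  have up: "[0..<6] = [0, 1, 2, 3, 4, 5]" by (simp add: upt_conv_Cons)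
  have r: "local_word base = [0, 1, 2, ?a, ?b, ?c]" by (simp add: local_word_def up l)
  have ne: "local_perm f base i \<noteq> local_perm f base j" if "i \<noteq> j" "i < 6" "j < 6" for i j
    using local_perm_inj[OF base_in_W] that by blast
  have "local_perm f base k \<in> {3, 4, 5}" if "k \<in> {3, 4, 5}" for k
    using ne[of k 0] ne[of k 1] ne[of k 2] local_perm_less[OF base_in_W, of k] l that by auto
  then have "?a \<in> {3, 4, 5}" "?b \<in> {3, 4, 5}" "?c \<in> {3, 4, 5}" by blast+
  moreover have "?a \<noteq> ?b" "?a \<noteq> ?c" "?b \<noteq> ?c" using ne by simp_all
  moreover have "carry (local_word base) [0,2,3,4,1,0] = local_word base"
    "carry (local_word base) [0,3,4,5,1,0] = local_word base"
    "carry (local_word base) [0,4,5,2,1,0] = local_word base"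
    using pentagon_walks by (intro local_word_closed_walk; simp)+
  ultimately have "local_word base = [0, 1, 2, 3, 4, 5]"
    using holonomy unfolding r by auto
  then have "?a = 3" "?b = 4" "?c = 5" unfolding r by simp_all
  moreover have "k \<in> {0, 1, 2, 3, 4, 5}" using assms(4) by auto
  ultimately show ?thesis using l by auto
qed

text \<open>
  Transport is a bijection, so at the next vertex every point is reached from a fixed one.
\<close>

lemma fixes_spreads:
  assumes U: "U \<in> W" and fU: "f U = U" and id: "\<And>k. k < 6 \<Longrightarrow> local_perm f U k = k" and y: "y < 6"
  shows "f (nbr y U) = nbr y U" "k < 6 \<Longrightarrow> local_perm f (nbr y U) k = k"
proof -
  show "f (nbr y U) = nbr y U" using aut_nbr[OF U y] id[OF y] fU by simp
  show "local_perm f (nbr y U) k = k" if k: "k < 6"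
  proof (cases "y = fibre U")
    case True
    then show ?thesis using nbr_fibre[OF U] id k by simp
  next
    case False
    have v: "fibre U < 6" by (rule fibre_less[OF U])
    have t: "pent_next (fibre U) y k < 6" using pent_next_less[OF v y False[symmetric] k] .
    show ?thesis
      using local_perm_transport[OF U y False t]
        pent_next_pent_next[OF v y False[symmetric] k] id v y t by simp
  qed
qed

end

section \<open>Connectivity and rigidity\<close>

text \<open>
  Connectivity in the form of an induction principle. Walking around a triangle \<open>0, a, b\<close>
  translates the fibre over 0 by the voltage of the triangle, and these voltages generate \<open>M\<close>.
\<close>

lemma nbr_induct:
  assumes U: "U \<in> W" and base: "P base"
    and step: "\<And>U y. U \<in> W \<Longrightarrow> P U \<Longrightarrow> y < 6 \<Longrightarrow> P (nbr y U)"
  shows "P U"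
proof -
  define R where "R x \<longleftrightarrow> P (V 0 x)" for x
  define D where "D = {d. \<forall>x. R x \<longrightarrow> R (x + d)}"
  have R_cong: "R x \<longleftrightarrow> R y" if "red p x = red p y" for x y
    using V_cong[OF that] by (simp add: R_def)
  have D_add: "c + d \<in> D" if "c \<in> D" "d \<in> D" for c d
    using that by (simp add: D_def flip: add.assoc)
  have D_scale: "scale (int n) d \<in> D" if "d \<in> D" for n d
  proof (induction n)
    case 0
    have "scale 0 d = 0" by (cases d) (simp add: scale_def zero_prod_def)
    then show ?case by (simp add: D_def)
  next
    case (Suc n)
    have "scale (int (Suc n)) d = scale (int n) d + d" by (cases d) (simp add: scale_def algebra_simps)
    then show ?case using D_add[OF Suc that] by simp
  qed
  have D_cong: "c \<in> D" if "red p c = red p d" "d \<in> D" for c d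
    using that R_cong red_add_cong unfolding D_def by blast
  have triangle: "voltage 0 a + voltage a b + voltage b 0 \<in> D" if "a < 6" "b < 6" for a b
  proof -
    have "R (x + (voltage 0 a + voltage a b + voltage b 0))" if "R x" for x
    proof -
      have "P (nbr 0 (nbr b (nbr a (V 0 x))))"
        using \<open>R x\<close> \<open>a < 6\<close> \<open>b < 6\<close> by (intro step nbr_in_W) (simp_all add: R_def V_in_W)
      then show ?thesis using \<open>a < 6\<close> \<open>b < 6\<close> by (simp add: R_def add.assoc)
    qed
    then show ?thesis by (simp add: D_def)
  qed
  have t: "voltage 0 1 + voltage 1 2 + voltage 2 0 = (6, 6, 12, 6)"
    "voltage 0 4 + voltage 4 1 + voltage 1 0 = (-6, 0, 0, 6)"
    "voltage 0 3 + voltage 3 2 + voltage 2 0 = (0, -6, 0, 6)"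
    "voltage 0 3 + voltage 3 1 + voltage 1 0 = (0, 0, -6, 6)"
    "voltage 0 1 + voltage 1 3 + voltage 3 0 = (0, 0, 6, -6)"
    "voltage 0 1 + voltage 1 4 + voltage 4 0 = (6, 0, 0, -6)"
    "voltage 0 2 + voltage 2 3 + voltage 3 0 = (0, 6, 0, -6)"
    by code_simp+
  have d: "(6, 6, 12, 6) \<in> D" "(-6, 0, 0, 6) \<in> D" "(0, -6, 0, 6) \<in> D" "(0, 0, -6, 6) \<in> D"
    "(0, 0, 6, -6) \<in> D" "(6, 0, 0, -6) \<in> D" "(0, 6, 0, -6) \<in> D"
    unfolding t[symmetric] by (rule triangle; simp)+
  \<comment> \<open>The lattice spanned by the triangles contains \<open>30 \<int>\<^sup>4\<close>, and 30 is invertible modulo \<open>p\<close>.\<close>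
  have e4: "(0, 0, 0, 30) \<in> D"
    using D_add[OF D_add[OF d(1,2)] D_add[OF d(3) D_add[OF d(4,4)]]] by simp
  have e: "(30, 0, 0, 0) \<in> D" "(0, 30, 0, 0) \<in> D" "(0, 0, 30, 0) \<in> D"
    using D_add[OF D_scale[OF d(6), of 5] e4] D_add[OF D_scale[OF d(7), of 5] e4]
      D_add[OF D_scale[OF d(5), of 5] e4] by (simp_all add: scale_def)
  have "coprime 30 (int p)"
  proof -
    have "\<not> p dvd 30"
    proof
      assume "p dvd 30"
      then have "p dvd 2 * 3 * 5" by simp
      then have "p dvd 2 \<or> p dvd 3 \<or> p dvd 5" using prime by (simp only: prime_dvd_mult_iff) blast
      then show False using ge7 by (auto dest!: dvd_imp_le)
    qed
    then show ?thesis
      using prime_imp_coprime[OF prime, of 30] by (metis coprime_commute coprime_int_iff of_nat_numeral)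
  qed
  then obtain n v where "n * 30 + v * int p = 1"
    using bezout_int[of 30 "int p"] by auto
  then have n: "(30 * n) mod int p = 1 mod int p"
    by (metis mod_mult_self1 mult.commute)
  have "(i, j, k, l) \<in> D" for i j k l
  proof (rule D_cong)
    let ?m = "\<lambda>i. int (nat ((n * i) mod int p))"
    have m: "(?m i * 30) mod int p = i mod int p" for i
    proof -
      have "(?m i * 30) mod int p = ((30 * n) * i) mod int p"
        by (simp add: mod_simps ac_simps)
      also have "\<dots> = (1 * i) mod int p"
        using n by (metis mod_mult_left_eq)
      finally show ?thesis by simp
    qed
    let ?d = "scale (?m i) (30, 0, 0, 0) + scale (?m j) (0, 30, 0, 0) + scale (?m k) (0, 0, 30, 0)
        + scale (?m l) (0, 0, 0, 30)"
    show "red p (i, j, k, l) = red p ?d"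
      using m by (simp add: red_def scale_def del: int_nat_eq)
    show "?d \<in> D" by (intro D_add D_scale e e4)
  qed
  then have "x \<in> D" for x by (cases x) simp
  then have "R (0 + x)" for x using base unfolding D_def R_def by blast
  then have all: "R x" for x by simp
  obtain j x where j: "j < 6" "U = V j x" using W_cases[OF U] .
  have "P (nbr j (V 0 (x - voltage 0 j)))"
    using all[of "x - voltage 0 j"] j(1) by (intro step) (simp_all add: R_def V_in_W)
  then show ?thesis using j by simp
qed

text \<open>The local permutation at the base vertex is trivial, and this property spreads along arcs.\<close>

lemma rigid:
  assumes f: "is_aut f" and fixed: "f base = base" "f (nbr 1 base) = nbr 1 base" "f (nbr 2 base) = nbr 2 base"
    and U: "U \<in> W"
  shows "f U = U"
proof -
  have "U \<in> W \<and> f U = U \<and> (\<forall>k<6. local_perm f U k = k)"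
    using U
  proof (rule nbr_induct)
    show "base \<in> W \<and> f base = base \<and> (\<forall>k<6. local_perm f base k = k)"
      using fixes_neighbours[OF f fixed] fixed(1) base_in_W by blast
    show "nbr y U \<in> W \<and> f (nbr y U) = nbr y U \<and> (\<forall>k<6. local_perm f (nbr y U) k = k)"
      if U: "U \<in> W \<and> f U = U \<and> (\<forall>k<6. local_perm f U k = k)" and y: "y < 6" for U y
    proof -
      have U': "U \<in> W" "f U = U" using U by blast+
      have l: "local_perm f U k = k" if "k < 6" for k using U that by blast
      show ?thesis
        using fixes_spreads[OF f U' l y] nbr_in_W[OF U'(1) y] by simp
    qed
  qed
  then show ?thesis by blast
qed

lemma \<delta>_0: "\<delta> 0 = id"
  by (rule ext) (auto simp: \<delta>_def reps_def perm_of_def in_five simp del: atLeastAtMost_iff)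

abbreviation "translate \<equiv> coset_graph.translate"

lemma translate_V:
  assumes "j < 6" "\<sigma> permutes {1..5}"
  shows "translate (elt y \<sigma>) (V j x) = V (point (vals (\<delta> j \<circ> \<sigma>))) (lam \<sigma> x + y)"
  using V_mult[OF assms] V_in_W[OF assms(1)] by (simp add: coset_graph.translate_def)

text \<open>
  A vertex has only one neighbour over each point, so it is enough to know how the elements
  of \<open>H\<close> permute the points.
\<close>

lemma two_arc_transitive_at_base:
  assumes "2 \<le> l" "l < 6"
  obtains g where "g \<in> carrier G" "translate g base = base" "translate g (nbr 1 base) = nbr 1 base"
    "translate g (nbr 2 base) = nbr l base"
proof -
  have "l \<in> set [2..<6]" using assms by (simp only: set_upt atLeastLessThan_iff)
  then obtain i k where ik: "point (act (reps ! 1) (affine i k [1,2,3,4,5])) = 1"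
    "point (act (reps ! 2) (affine i k [1,2,3,4,5])) = l"
    using two_arc_words by blast
  define \<sigma> where "\<sigma> = affine_perm i k"
  have \<sigma>: "\<sigma> permutes {1..5}" "preserves_points \<sigma>"
    unfolding \<sigma>_def by (rule affine_perm_permutes, rule affine_perm_preserves)
  have "vals \<sigma> = affine i k [1,2,3,4,5]"
    using vals_affine[of i k id] by (simp add: \<sigma>_def vals_def)
  then have pt: "point (vals (\<delta> j \<circ> \<sigma>)) = point (act (reps ! j) (affine i k [1,2,3,4,5]))" for j
    by (simp add: vals_comp \<delta>_def del: o_apply)
  have pt0: "point (vals (\<delta> 0 \<circ> \<sigma>)) = 0"
  proof -
    have "point (vals (\<sigma> \<circ> \<delta> 0)) = 0"
      using \<sigma>(2) \<delta>_permutes[of 0] point_\<delta>[of 0] by (simp add: preserves_points_def)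
    then show ?thesis by (simp add: \<delta>_0)
  qed
  let ?g = "elt 0 \<sigma>"
  have g: "is_aut (translate ?g)" by (rule is_aut_translate[OF elt_in_G[OF \<sigma>(1)]])
  have o: "translate ?g base = base" by (simp add: translate_V \<sigma> pt0 del: o_apply)
  have nbr: "translate ?g (nbr j base) = nbr (point (vals (\<delta> j \<circ> \<sigma>))) base" if "j < 6" for j
  proof -
    have "local_perm (translate ?g) base j = point (vals (\<delta> j \<circ> \<sigma>))"
      using that point_less[OF permutes_compose[OF \<sigma>(1) \<delta>_permutes[OF that]]]
      by (simp add: local_perm_def translate_V \<sigma> del: o_apply)
    then show ?thesis using aut_nbr[OF g base_in_W that] o by simp
  qed
  show thesis
    using nbr[of 1] nbr[of 2] ik by (intro that[OF elt_in_G[OF \<sigma>(1), of 0] o]) (simp_all add: pt)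
qed

text \<open>
  Arc-transitivity and the transitivity of arc stabilisers give a translation that agrees with
  \<open>f\<close> on the 2-arc at the base vertex; then they agree everywhere.
\<close>

lemma aut_is_translation:
  assumes f: "is_aut f"
  obtains g where "g \<in> carrier G" "\<And>U. U \<in> W \<Longrightarrow> f U = translate g U"
proof -
  interpret G: group G by (rule group_G)
  have arc: "(base, nbr 1 base) \<in> E" using arc_iff[OF base_in_W, of "nbr 1 base"] by (auto intro!: exI[of _ 1])
  have nbW: "nbr k base \<in> W" if "k < 6" for k using nbr_in_W[OF base_in_W that] .
  have "(f base, f (nbr 1 base)) \<in> E" using arc f base_in_W nbW[of 1] by (simp add: is_aut_def)
  then obtain a where a: "a \<in> carrier G" "translate a base = f base" "translate a (nbr 1 base) = f (nbr 1 base)"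
    using coset_graph.arc_transitive[OF arc] by blast
  have cancel: "translate (inv\<^bsub>G\<^esub> g) (translate g U) = U" "translate g (translate (inv\<^bsub>G\<^esub> g) U) = U"
    if "g \<in> carrier G" "U \<in> W" for g U
    using that by (simp_all add: coset_graph.translate_mult coset_graph.translate_one)
  \<comment> \<open>\<open>f1\<close> fixes an arc and \<open>f2\<close> a 2-arc.\<close>
  define f1 where "f1 U = translate (inv\<^bsub>G\<^esub> a) (f U)" for U
  have f1: "is_aut f1"
    unfolding f1_def by (rule is_aut_comp[OF is_aut_translate f]) (simp add: a(1))
  have f1_fix: "f1 base = base" "f1 (nbr 1 base) = nbr 1 base"
    unfolding f1_def a(2,3)[symmetric] using cancel[OF a(1)] base_in_W nbW[of 1] by simp_all
  define l where "l = local_perm f1 base 2"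
  have l: "f1 (nbr 2 base) = nbr l base" "l < 6"
    using aut_nbr[OF f1 base_in_W, of 2] local_perm_less[OF f1 base_in_W, of 2] f1_fix by (simp_all add: l_def)
  have "l \<noteq> 0" "l \<noteq> 1"
    using local_perm_inj[OF f1 base_in_W, of 2 0] local_perm_inj[OF f1 base_in_W, of 2 1] f1_fix
    by (auto simp: l_def local_perm_def voltage_diag)
  then have "2 \<le> l" by simp
  then obtain b where b: "b \<in> carrier G" "translate b base = base" "translate b (nbr 1 base) = nbr 1 base"
    "translate b (nbr 2 base) = nbr l base"
    using two_arc_transitive_at_base l(2) by blast
  define f2 where "f2 U = translate (inv\<^bsub>G\<^esub> b) (f1 U)" for U
  have f2: "is_aut f2"
    unfolding f2_def by (rule is_aut_comp[OF is_aut_translate f1]) (simp add: b(1))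
  have "f2 base = base" "f2 (nbr 1 base) = nbr 1 base" "f2 (nbr 2 base) = nbr 2 base"
    using cancel(1)[OF b(1) base_in_W] cancel(1)[OF b(1) nbW[of 1]] cancel(1)[OF b(1) nbW[of 2]] b f1_fix l(1)
    by (simp_all add: f2_def)
  then have id: "f2 U = U" if "U \<in> W" for U using rigid[OF f2] that by blast
  have "f U = translate (b \<otimes>\<^bsub>G\<^esub> a) U" if U: "U \<in> W" for U
  proof -
    have fU: "f U \<in> W" "f1 U \<in> W" using aut_in_W[OF f U] aut_in_W[OF f1 U] .
    have "translate b U = f1 U" using id[OF U] cancel(2)[OF b(1) fU(2)] by (simp add: f2_def)
    then have "translate a (translate b U) = f U" using cancel(2)[OF a(1) fU(1)] by (simp add: f1_def)
    then show ?thesis using coset_graph.translate_mult[OF b(1) a(1) U] by simp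
  qed
  then show thesis using a(1) b(1) by (intro that[of "b \<otimes>\<^bsub>G\<^esub> a"]) auto
qed

text \<open>
  An element that fixes all vertices over the point 0 acts trivially on \<open>M\<close>.
\<close>

lemma translate_faithful:
  assumes "g \<in> carrier G" "\<forall>U \<in> W. translate g U = U"
  shows "g = \<one>\<^bsub>G\<^esub>"
proof -
  obtain y \<sigma> where \<sigma>: "\<sigma> permutes {1..5}" and g: "g = elt y \<sigma>" using G_cases[OF assms(1)] .
  have fixed: "red p (lam \<sigma> x + y) = red p x" for x
  proof -
    have "V (point (vals (\<delta> 0 \<circ> \<sigma>))) (lam \<sigma> x + y) = V 0 x"
      using assms(2) V_in_W[of 0 x] translate_V[of 0 \<sigma> y x] \<sigma> by (simp add: g)
    then show ?thesis
      using V_eq_iff[OF point_less[OF permutes_compose[OF \<sigma> \<delta>_permutes[of 0]]], of 0] by simp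
  qed
  have y: "red p y = red p 0" using fixed[of 0] by simp
  have "red p (lam \<sigma> x) = red p x" for x
    using fixed[of x] red_add_cong[OF refl y, of "lam \<sigma> x"] by simp
  then have "\<sigma> = id"
    by (intro Lam_eq_id[OF \<sigma>]) (simp add: Lam_apply gen_def)
  then show ?thesis using elt_cong[OF y] by (simp add: g one_G)
qed

lemma G_iso_aut: "G \<cong> graph_aut_group (graph_6p4 p)"
proof -
  have "(\<lambda>g. translate (inv\<^bsub>G\<^esub> g)) \<in> iso G (graph_aut_group coset_graph.X)"
  proof (rule coset_graph.iso_graph_aut_group)
    show "\<exists>g\<in>carrier G. \<forall>U\<in>W. f U = translate g U" if "f \<in> graph_auts coset_graph.X" for f
      using aut_is_translation[of f] that unfolding is_aut_iff by metis
  qed (rule translate_faithful)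
  then show ?thesis unfolding X_eq is_iso_def by blast
qed

section \<open>The theorem\<close>

lemma finite_G: "finite (carrier G)"
proof -
  have "finite (carrier M)"
    by (simp add: grpM_def carrier_integer_mod_group)
  moreover have "finite {\<sigma>. \<sigma> permutes {1..5::nat}}" by (rule finite_permutations) simp
  ultimately show ?thesis by (simp add: grpG_def semidirect_product_def carrier_L)
qed

lemma pair_graph_X: "pair_graph coset_graph.X"
  by (rule coset_graph.pair_graph_X[OF finite_G])

lemma connected_X: "Digraph_Component.connected (with_proj coset_graph.X)"
proof -
  interpret X: pair_graph coset_graph.X by (rule pair_graph_X)
  have reach: "base \<rightarrow>\<^sup>*\<^bsub>with_proj coset_graph.X\<^esub> U" if "U \<in> W" for U
    using that
  proof (rule nbr_induct)
    show "base \<rightarrow>\<^sup>*\<^bsub>with_proj coset_graph.X\<^esub> base" using base_in_W by simp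
    fix U and y :: nat assume U: "U \<in> W" "base \<rightarrow>\<^sup>*\<^bsub>with_proj coset_graph.X\<^esub> U" and y: "y < 6"
    show "base \<rightarrow>\<^sup>*\<^bsub>with_proj coset_graph.X\<^esub> nbr y U"
    proof (cases "y = fibre U")
      case True
      then show ?thesis using U nbr_fibre by simp
    next
      case False
      then have "(U, nbr y U) \<in> E" using arc_iff[OF U(1)] y by blast
      with U(2) show ?thesis by (rule X.reachable_adj_trans)
    qed
  qed
  have "U \<rightarrow>\<^sup>*\<^bsub>with_proj coset_graph.X\<^esub> Y" if "U \<in> W" "Y \<in> W" for U Y
    by (rule X.reachable_trans[OF X.symmetric_reachable'[OF reach[OF that(1)]] reach[OF that(2)]])
  note reachable = X.reachable_mk_symmetricI[OF this]
  show ?thesis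
    unfolding connected_def strongly_connected_def
  proof (intro conjI ballI)
    show "verts (with_proj (mk_symmetric (with_proj coset_graph.X))) \<noteq> {}"
      using base_in_W by auto
  qed (use reachable in auto)
qed

lemma valency_X: "regular_of_valency 5 coset_graph.X"
  unfolding regular_of_valency_def
proof
  fix U assume "U \<in> pverts coset_graph.X"
  then have U: "U \<in> W" by simp
  have arcs: "out_arcs (with_proj coset_graph.X) U = (\<lambda>k. (U, nbr k U)) ` ({..<6} - {fibre U})"
    (is "?A = ?B")
  proof (intro equalityI subsetI)
    fix e assume "e \<in> ?A"
    then have "(U, snd e) \<in> E" "e = (U, snd e)" by (auto simp: out_arcs_def)
    moreover obtain k where "k < 6" "k \<noteq> fibre U" "snd e = nbr k U"
      using arc_iff[OF U, of "snd e"] \<open>(U, snd e) \<in> E\<close> by blast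
    ultimately show "e \<in> ?B" by (intro image_eqI[of _ _ k]) simp_all
  next
    fix e assume "e \<in> ?B"
    then obtain k where k: "k < 6" "k \<noteq> fibre U" "e = (U, nbr k U)" by blast
    then have "e \<in> E" using arc_iff[OF U, of "nbr k U"] by blast
    then show "e \<in> ?A" using k(3) by (simp add: out_arcs_def)
  qed
  have inj: "inj_on (\<lambda>k. (U, nbr k U)) ({..<6} - {fibre U})"
  proof (rule inj_onI)
    fix k l assume "k \<in> {..<6} - {fibre U}" "l \<in> {..<6} - {fibre U}" "(U, nbr k U) = (U, nbr l U)"
    then have "k < 6" "l < 6" "nbr k U = nbr l U" by blast+
    then show "k = l" using fibre_nbr[OF U] by metis
  qed
  have "card ({..<6} - {fibre U}) = 5" using fibre_less[OF U] by simp
  then show "out_degree (with_proj coset_graph.X) U = 5"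
    unfolding out_degree_def arcs card_image[OF inj] .
qed

lemma point_\<alpha>: "\<forall>j \<in> set [0..<6]. point (act (reps ! j) word_alpha) = j \<longleftrightarrow> j = 0"
  by code_simp

text \<open>
  A vector fixed by the cyclic shift modulo the diagonal has coordinates in arithmetic
  progression of period 5, so the common difference \<open>t\<close> satisfies \<open>5t = 0\<close>.
\<close>

lemma lam_\<alpha>_fixes: "red p (lam \<alpha> x) = red p x \<Longrightarrow> red p x = 0"
proof -
  assume fixed: "red p (lam \<alpha> x) = red p x"
  obtain i j k l where x: "x = (i, j, k, l)" by (cases x)
  have d: "int p dvd - l - i" "int p dvd i - l - j" "int p dvd j - l - k" "int p dvd k - l - l"
    using fixed by (simp_all add: x lam_\<alpha> red_def mod_eq_dvd_iff)
  have "int p dvd - ((- l - i) + (i - l - j) + (j - l - k) + (k - l - l))"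
    using d by (intro dvd_minus_iff[THEN iffD2] dvd_add)
  then have "int p dvd 5 * l" by (simp add: algebra_simps)
  moreover have "\<not> int p dvd 5"
    using ge7 by (auto dest!: zdvd_imp_le)
  ultimately have l: "int p dvd l"
    using prime by (auto simp: prime_dvd_mult_iff)
  have i: "int p dvd i" using dvd_add[OF d(1) l] by simp
  have j: "int p dvd j" using dvd_diff[OF dvd_diff[OF i l] d(2)] by simp
  have k: "int p dvd k" using dvd_diff[OF dvd_diff[OF j l] d(3)] by simp
  show "red p x = 0" using i j k l by (simp add: x red_def zero_prod_def)
qed

text \<open>
  The shift \<open>\<alpha>\<close> fixes only the point 0, and over that point only the zero vector. All other
  cycles have length 5.
\<close>

lemma quasi_semiregular_\<alpha>: "quasi_semiregular coset_graph.X (translate (elt 0 \<alpha>))"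
proof -
  let ?f = "translate (elt 0 \<alpha>)"
  have g: "elt 0 \<alpha> \<in> carrier G" by (rule elt_in_G[OF abg_permutes(1)])
  have f_V: "?f (V j x) = V (point (act (reps ! j) word_alpha)) (lam \<alpha> x)" if "j < 6" for j x
    using translate_V[OF that abg_permutes(1), of 0 x]
    by (simp add: vals_comp \<delta>_def words_length alpha_word del: o_apply)
  have pt: "point (act (reps ! j) word_alpha) < 6" if "j < 6" for j
    using point_less[OF permutes_compose[OF abg_permutes(1) \<delta>_permutes[OF that]]]
    by (simp add: vals_comp \<delta>_def words_length alpha_word del: o_apply)
  have fixed: "?f U = U \<longleftrightarrow> U = base" if "U \<in> W" for U
  proof -
    obtain j x where U: "j < 6" "U = V j x" using W_cases[OF \<open>U \<in> W\<close>] .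
    have "j \<in> set [0..<6]" using U(1) by simp
    then have j: "point (act (reps ! j) word_alpha) = j \<longleftrightarrow> j = 0" by (rule bspec[OF point_\<alpha>])
    have x: "red p (lam \<alpha> x) = red p x \<longleftrightarrow> red p x = red p 0"
    proof
      assume "red p (lam \<alpha> x) = red p x"
      then show "red p x = red p 0" using lam_\<alpha>_fixes by (simp only: red_0)
    next
      assume "red p x = red p 0"
      then show "red p (lam \<alpha> x) = red p x" using red_lam_cong[of x 0 \<alpha>] by (simp only: lam_0)
    qed
    have "?f U = U \<longleftrightarrow> point (act (reps ! j) word_alpha) = j \<and> red p (lam \<alpha> x) = red p x"
      by (simp only: U(2) f_V[OF U(1)] V_eq_iff[OF pt[OF U(1)] U(1)])
    also have "\<dots> \<longleftrightarrow> j = 0 \<and> red p x = red p 0"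
      by (simp only: j x)
    also have "\<dots> \<longleftrightarrow> U = base" using V_eq_iff[OF U(1), of 0 x 0] by (simp only: U(2))
    finally show ?thesis .
  qed
  have pow: "(?f ^^ n) U = translate (elt 0 (\<alpha> ^^ n)) U \<and> (?f ^^ n) U \<in> W" if U: "U \<in> W" for n U
  proof (induction n)
    case 0
    then show ?case using coset_graph.translate_one[OF U] U by (simp add: one_G id_def)
  next
    case (Suc n)
    have p: "(\<alpha> ^^ n) permutes {1..5}" by (rule funpow_permutes[OF abg_permutes(1)])
    have "(?f ^^ Suc n) U = ?f (translate (elt 0 (\<alpha> ^^ n)) U)" using Suc by simp
    also have "\<dots> = translate (elt 0 (\<alpha> ^^ n) \<otimes>\<^bsub>G\<^esub> elt 0 \<alpha>) U"
      by (rule coset_graph.translate_mult[OF elt_in_G[OF p] g U])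
    also have "elt 0 (\<alpha> ^^ n) \<otimes>\<^bsub>G\<^esub> elt 0 \<alpha> = elt 0 (\<alpha> ^^ Suc n)"
      by (simp only: elt_mult[OF p abg_permutes(1)] lam_0 add_0 funpow_Suc_right)
    finally have "(?f ^^ Suc n) U = translate (elt 0 (\<alpha> ^^ Suc n)) U" .
    moreover have "(?f ^^ Suc n) U \<in> W"
      using coset_graph.translate_closed[OF g conjunct2[OF Suc]] by simp
    ultimately show ?case ..
  qed
  have "\<alpha> ^^ 5 = id"
  proof
    fix t
    have five_steps: "(h ^^ 5) s = h (h (h (h (h s))))" for h :: "nat \<Rightarrow> nat" and s
      by (simp add: numeral_eq_Suc)
    have step: "\<alpha> 1 = 5" "\<alpha> 2 = 1" "\<alpha> 3 = 2" "\<alpha> 4 = 3" "\<alpha> 5 = 4"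
      by (simp_all add: perm_of_def word_alpha_def)
    show "(\<alpha> ^^ 5) t = id t"
    proof (cases "t \<in> {1..5}")
      case True
      then show ?thesis unfolding in_five by (elim disjE) (simp_all only: five_steps step id_apply)
    next
      case False
      then show ?thesis using permutes_not_in[OF abg_permutes(1) False] by (simp only: five_steps id_apply)
    qed
  qed
  then have "(?f ^^ 5) U = U" if "U \<in> W" for U
    using pow[OF that, of 5] coset_graph.translate_one[OF that] by (simp add: one_G)
  then have orbits: "card (orbit ?f U) = 5" if "U \<in> W" "?f U \<noteq> U" for U
    using card_orbit_prime[of 5 ?f U] that by simp
  have "?f \<noteq> \<one>\<^bsub>graph_aut_group coset_graph.X\<^esub>"
  proof
    assume eq: "?f = \<one>\<^bsub>graph_aut_group coset_graph.X\<^esub>"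
    have "?f (V 1 0) = V 1 0"
      using V_in_W[of 1 0] unfolding eq by (simp add: graph_aut_group_def BijGroup_def)
    then show False using fixed[of "V 1 0"] V_in_W[of 1 0] by (simp add: V_eq_iff)
  qed
  then show ?thesis
    using coset_graph.translate_aut[OF g] fixed orbits base_in_W by (auto simp: quasi_semiregular_def)
qed

lemma semidirect_S5_iso_G: "(\<lambda>(x, \<sigma>). (x, Lam p \<sigma>)) \<in> iso (semidirect_product M (sym_group 5) (Lam p)) G"
proof -
  have "bij_betw (\<lambda>(x, \<sigma>). (x, Lam p \<sigma>)) (carrier M \<times> {\<sigma>. \<sigma> permutes {1..5}})
      (carrier M \<times> Lam p ` {\<sigma>. \<sigma> permutes {1..5}})"
    using Lam_inj by (auto simp: bij_betw_def inj_on_def)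
  then show ?thesis
    by (auto simp: iso_def hom_def semidirect_product_def grpG_def carrier_L inv_L mult_L sym_group_carrier
        sym_group_mult sym_group_inv_equality)
       (auto simp: sym_group_def)
qed

lemma semidirect_S5_group: "group (semidirect_product M (sym_group 5) (Lam p))"
proof (rule semidirect_product_group[OF group_M sym_group_is_group])
  show "Lam p \<sigma> \<in> hom M M" if "\<sigma> \<in> carrier (sym_group 5)" for \<sigma>
    using Lam_auto[of p \<sigma>] that by (simp add: sym_group_carrier auto_def)
  show "Lam p (\<sigma> \<otimes>\<^bsub>sym_group 5\<^esub> \<tau>) x = Lam p \<tau> (Lam p \<sigma> x)"
    if "\<sigma> \<in> carrier (sym_group 5)" "\<tau> \<in> carrier (sym_group 5)" "x \<in> carrier M" for \<sigma> \<tau> x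
    using that by (simp add: sym_group_carrier sym_group_mult Lam_comp compose_def del: o_apply)
  show "Lam p \<one>\<^bsub>sym_group 5\<^esub> x = x" if "x \<in> carrier M" for x
    using that by (simp add: sym_group_one Lam_id)
qed

lemma aut_group_iso:
  "graph_aut_group (graph_6p4 p) \<cong> semidirect_product M (sym_group 5) (Lam p)"
proof -
  have "semidirect_product M (sym_group 5) (Lam p) \<cong> graph_aut_group (graph_6p4 p)"
    using semidirect_S5_iso_G G_iso_aut iso_trans unfolding is_iso_def by blast
  then show ?thesis by (rule group.iso_sym[OF semidirect_S5_group])
qed

end

theorem theorem6p1:
  fixes p :: nat
  assumes "prime p" and "p \<ge> 7"
  shows "pair_graph (graph_6p4 p)
    \<and> Digraph_Component.connected (with_proj (graph_6p4 p))
    \<and> regular_of_valency 5 (graph_6p4 p)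
    \<and> symmetric_graph (graph_6p4 p)
    \<and> (\<exists>f. quasi_semiregular (graph_6p4 p) f)
    \<and> (\<exists>\<phi> \<in> iso (sym_group 5) (grpL p).
         graph_aut_group (graph_6p4 p) \<cong> semidirect_product (grpM p) (sym_group 5) \<phi>)"
proof -
  interpret big_prime p using assms by unfold_locales
  show ?thesis
    using pair_graph_X connected_X valency_X coset_graph.symmetric_graph_X quasi_semiregular_\<alpha>
      Lam_iso aut_group_iso
    unfolding X_eq by blast
qed

end
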